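(* Let $G$ be a finite group, expressed as a subgroup of the symmetric group $S_n$, which is represented as a subgroup of $\mathbf{U}(n)$ by permutations of the coordinates of $\mathbb{C}^n$. Then there exist an integer $N$ and a polynomial proper holomorphic map $f:\mathbb{B}^n\to\mathbb{B}^N$ with $\Gamma_f=G$.
   Context: $\mathbb{B}^n$ is the open unit ball of $\mathbb{C}^n$, $\mathrm{Aut}(\mathbb{B}^n)$ is its group of holomorphic automorphisms, and $\mathbf{U}(n)\leqslant\mathrm{Aut}(\mathbb{B}^n)$ is the unitary group. The symmetric group $S_n$ is identified with the subgroup of $\mathbf{U}(n)$ of unitary maps that permute the coordinates, and $G\leqslant S_n$ is thereby identified with a subgroup of $\mathbf{U}(n)$. The Hermitian invariant group of a rational proper map $f:\mathbb{B}^n\to\mathbb{B}^N$ is $$\Gamma_f=\{\gamma\in\mathrm{Aut}(\mathbb{B}^n):\ \text{there is } \psi\in\mathrm{Aut}(\mathbb{B}^N)\text{ with } f\circ\gamma=\psi\circ f\}.$$ *)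

theory Defs
  imports
    "HOL-Analysis.Analysis"
    "HOL-Algebra.Sym_Groups"
    "HOL-Algebra.Bij"
begin

text \<open>
  The target dimension is existentially quantified, so complex n-space cannot be a type such as
  \<open>complex ^ 'n\<close>. Its points are the sequences vanishing outside \<open>{1..n}\<close>; the index set is the one
  on which \<^const>\<open>sym_group\<close> acts. On this subset the topology of the type \<open>nat \<Rightarrow> complex\<close>
  (the product topology) is the Euclidean topology.
\<close>

definition cn_space :: "nat \<Rightarrow> (nat \<Rightarrow> complex) set" where
  "cn_space n = {z. \<forall>i. i \<notin> {1..n} \<longrightarrow> z i = 0}"

definition cn_norm :: "nat \<Rightarrow> (nat \<Rightarrow> complex) \<Rightarrow> real" where
  "cn_norm n z = L2_set (\<lambda>i. cmod (z i)) {1..n}"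

definition cn_ball :: "nat \<Rightarrow> (nat \<Rightarrow> complex) set" where
  "cn_ball n = {z \<in> cn_space n. cn_norm n z < 1}"

text \<open>Each component has a complex-linear Frechet derivative \<open>h \<mapsto> \<Sum>i=1..n. a i * h i\<close>
  at every point of the ball.\<close>

definition holomorphic_ball_map ::
    "nat \<Rightarrow> nat \<Rightarrow> ((nat \<Rightarrow> complex) \<Rightarrow> nat \<Rightarrow> complex) \<Rightarrow> bool" where
  "holomorphic_ball_map n N f \<longleftrightarrow>
     (\<forall>z \<in> cn_ball n. \<forall>j \<in> {1..N}. \<exists>a :: nat \<Rightarrow> complex. \<forall>\<epsilon>>0. \<exists>\<delta>>0. \<forall>w \<in> cn_ball n.
        cn_norm n (\<lambda>i. w i - z i) < \<delta> \<longrightarrow>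
        cmod (f w j - f z j - (\<Sum>i=1..n. a i * (w i - z i))) \<le> \<epsilon> * cn_norm n (\<lambda>i. w i - z i))"

text \<open>The elements of \<^const>\<open>Bij\<close> are extensional, so equal maps of the ball are equal functions.\<close>

definition Aut_ball :: "nat \<Rightarrow> ((nat \<Rightarrow> complex) \<Rightarrow> nat \<Rightarrow> complex) set" where
  "Aut_ball n = {\<phi> \<in> Bij (cn_ball n).
     holomorphic_ball_map n n \<phi> \<and> holomorphic_ball_map n n (inv_into (cn_ball n) \<phi>)}"

definition proper_holomorphic_ball_map ::
    "nat \<Rightarrow> nat \<Rightarrow> ((nat \<Rightarrow> complex) \<Rightarrow> nat \<Rightarrow> complex) \<Rightarrow> bool" where
  "proper_holomorphic_ball_map n N f \<longleftrightarrow>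
     f \<in> cn_ball n \<rightarrow> cn_ball N \<and> holomorphic_ball_map n N f \<and>
     (\<forall>K. K \<subseteq> cn_ball N \<and> compact K \<longrightarrow> compact (f -` K \<inter> cn_ball n))"

text \<open>The set \<open>A\<close> consists of multi-indices; only their entries in \<open>{1..n}\<close> matter.\<close>

definition polynomial_ball_map ::
    "nat \<Rightarrow> nat \<Rightarrow> ((nat \<Rightarrow> complex) \<Rightarrow> nat \<Rightarrow> complex) \<Rightarrow> bool" where
  "polynomial_ball_map n N f \<longleftrightarrow>
     (\<forall>j \<in> {1..N}. \<exists>(A :: (nat \<Rightarrow> nat) set) (c :: (nat \<Rightarrow> nat) \<Rightarrow> complex). finite A \<and>
        (\<forall>z \<in> cn_ball n. f z j = (\<Sum>\<alpha>\<in>A. c \<alpha> * (\<Prod>i=1..n. z i ^ \<alpha> i))))"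

definition hermitian_invariant_group ::
    "nat \<Rightarrow> nat \<Rightarrow> ((nat \<Rightarrow> complex) \<Rightarrow> nat \<Rightarrow> complex) \<Rightarrow>
      ((nat \<Rightarrow> complex) \<Rightarrow> nat \<Rightarrow> complex) set" where
  "hermitian_invariant_group n N f =
     {\<gamma> \<in> Aut_ball n. \<exists>\<psi> \<in> Aut_ball N. \<forall>z \<in> cn_ball n. f (\<gamma> z) = \<psi> (f z)}"

text \<open>The inverse makes \<open>\<sigma> \<mapsto> perm_unitary n \<sigma>\<close> a homomorphism; it sends the \<open>i\<close>-th
  standard basis vector to the \<open>\<sigma> i\<close>-th.\<close>

definition perm_unitary :: "nat \<Rightarrow> (nat \<Rightarrow> nat) \<Rightarrow> (nat \<Rightarrow> complex) \<Rightarrow> nat \<Rightarrow> complex" where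
  "perm_unitary n \<sigma> = (\<lambda>z \<in> cn_ball n. \<lambda>i. z (Hilbert_Choice.inv \<sigma> i))"

end

theory Submission
  imports Defs "HOL-Complex_Analysis.Conformal_Mappings"
begin

text \<open>
  The map is built from the tensor powers of the identity. Juxtaposing those of degrees \<open>2\<close>, \<open>3\<close>
  and \<open>D\<close> with equal weights gives a proper map whose squared norm is a function of
  \<open>r = \<parallel>z\<parallel>\<^sup>2\<close> alone. A unitary change of coordinates in the target makes some chosen polynomials
  \<open>p\<close> components of this map, and replacing such a component \<open>p\<close> by the \<open>n\<close> components
  \<open>p z\<^sub>1, \<dots>, p z\<^sub>n\<close> keeps the map proper while lowering its squared norm by
  \<open>(1 - r) \<bar>p\<bar>\<^sup>2\<close>. The chosen \<open>p\<close> are multiples of \<open>z\<^sub>i\<^sup>2 + z\<^sub>i\<^sup>3\<close> for every \<open>i\<close>, and the monomials of a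
  \<open>G\<close>-orbit \<open>W\<close> of words. The resulting components are permuted by \<open>G\<close>, which puts \<open>G\<close> into the
  invariant group; what the squared norm remembers besides \<open>r\<close> is the sum of the \<open>\<bar>p\<bar>\<^sup>2\<close>, called the
  defect below.

  The converse inclusion avoids the classification of the automorphisms of the ball. The derivative of
  the map vanishes exactly at the origin, and \<open>f \<circ> \<gamma> = \<psi> \<circ> f\<close> makes \<open>\<gamma>\<close> map critical points
  of \<open>f\<close> to critical points; so \<open>\<gamma>\<close> fixes the origin, and hence so does \<open>\<psi>\<close>
  (\<open>intertwined_critical_point\<close>, \<open>critical_point_is_origin\<close>). By the Schwarz lemma \<open>\<gamma>\<close> is then
  linear and both \<open>\<gamma>\<close> and \<open>\<psi>\<close> preserve the norm (\<open>Aut_ball_linear\<close>, \<open>Aut_ball_norm\<close>),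
  so \<open>\<gamma>\<close> preserves the defect.

  The part of the defect that is odd in \<open>z\<close> is a multiple of \<open>\<Sum> \<bar>z\<^sub>i\<bar>\<^sup>4 Re z\<^sub>i\<close>. On the unit sphere it
  is maximal exactly at the basis vectors, so \<open>\<gamma>\<close> permutes the basis
  (\<open>defect_preserving_Aut_is_permutation\<close>). The words in \<open>W\<close> contain the letters with distinct
  multiplicities, and comparing the growth of the remaining monomials along a suitable curve identifies
  the permutation as an element of \<open>G\<close>, by strictness in the rearrangement inequality
  (\<open>separating_words_exist\<close>).
\<close>

section \<open>Norms and points of the ball\<close>

lemma cn_norm_power2: "(cn_norm n z)\<^sup>2 = (\<Sum>i=1..n. (cmod (z i))\<^sup>2)"
  by (simp add: cn_norm_def L2_set_def sum_nonneg)

lemma cn_norm_nonneg [simp]: "0 \<le> cn_norm n z"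
  by (simp add: cn_norm_def)

lemma cn_norm_less_1_iff: "cn_norm n z < 1 \<longleftrightarrow> (cn_norm n z)\<^sup>2 < 1"
  using power_strict_mono[of "cn_norm n z" 1 2] one_le_power[of "cn_norm n z" 2]
  by (metis cn_norm_nonneg linorder_not_less one_power2 zero_less_numeral)

lemma cn_norm_zero [simp]: "cn_norm n (\<lambda>i. 0) = 0"
  by (simp add: cn_norm_def L2_set_def)

lemma cn_norm_eq_0_imp: "cn_norm n z = 0 \<Longrightarrow> i \<in> {1..n} \<Longrightarrow> z i = 0"
  unfolding cn_norm_def by (subst (asm) L2_set_eq_0_iff) auto

lemma cn_space_eqI:
  assumes "z \<in> cn_space n" "w \<in> cn_space n" "\<And>i. i \<in> {1..n} \<Longrightarrow> z i = w i"
  shows "z = w"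
proof
  show "z i = w i" for i using assms by (cases "i \<in> {1..n}") (auto simp: cn_space_def)
qed

lemma cn_norm_eq_0_iff: "z \<in> cn_space n \<Longrightarrow> cn_norm n z = 0 \<longleftrightarrow> z = (\<lambda>i. 0)"
  by (auto intro!: cn_space_eqI[of z n] cn_norm_eq_0_imp simp: cn_space_def)

lemma cn_norm_scale: "cn_norm n (\<lambda>i. t * z i) = cmod t * cn_norm n z"
  by (simp add: cn_norm_def norm_mult L2_set_right_distrib)

lemma cn_norm_component_le: "i \<in> {1..n} \<Longrightarrow> cmod (z i) \<le> cn_norm n z"
  unfolding cn_norm_def by (rule member_le_L2_set) auto

lemma cn_norm_le_sum: "cn_norm n z \<le> (\<Sum>i=1..n. cmod (z i))"
  unfolding cn_norm_def by (rule L2_set_le_sum) auto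

lemma zero_in_cn_ball [simp]: "(\<lambda>i. 0) \<in> cn_ball n"
  by (simp add: cn_ball_def cn_space_def)

lemma cn_ball_space: "z \<in> cn_ball n \<Longrightarrow> z \<in> cn_space n"
  by (simp add: cn_ball_def)

lemma cn_ball_norm: "z \<in> cn_ball n \<Longrightarrow> cn_norm n z < 1"
  by (simp add: cn_ball_def)

lemma cn_ball_scale:
  assumes "z \<in> cn_space n" "cmod t * cn_norm n z < 1"
  shows "(\<lambda>i. t * z i) \<in> cn_ball n"
  using assms by (auto simp: cn_ball_def cn_space_def cn_norm_scale)

section \<open>The Schwarz lemma on the ball and automorphisms fixing the origin\<close>

definition cn_inner :: "nat \<Rightarrow> (nat \<Rightarrow> complex) \<Rightarrow> (nat \<Rightarrow> complex) \<Rightarrow> complex" where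
  "cn_inner n z w = (\<Sum>i=1..n. z i * cnj (w i))"

lemma cn_inner_self: "cn_inner n z z = of_real ((cn_norm n z)\<^sup>2)"
  unfolding cn_inner_def cn_norm_power2 of_real_sum
  by (rule sum.cong) (auto simp: complex_norm_square[symmetric] simp del: of_real_power)

lemma cn_inner_le: "cmod (cn_inner n z w) \<le> cn_norm n z * cn_norm n w"
proof -
  have "cmod (cn_inner n z w) \<le> (\<Sum>i=1..n. \<bar>cmod (z i)\<bar> * \<bar>cmod (w i)\<bar>)"
    unfolding cn_inner_def by (rule order_trans[OF norm_sum]) (simp add: norm_mult)
  also have "\<dots> \<le> cn_norm n z * cn_norm n w"
    unfolding cn_norm_def by (rule L2_set_mult_ineq)
  finally show ?thesis .
qed

text \<open>Restricting to complex lines through the origin reduces what follows to functions of one variable.\<close>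

lemma slice_holomorphic:
  assumes h: "holomorphic_ball_map n N h" and u: "u \<in> cn_space n" "cn_norm n u \<le> 1"
    and j: "j \<in> {1..N}"
  shows "(\<lambda>t. h (\<lambda>i. t * u i) j) holomorphic_on ball 0 1"
  unfolding holomorphic_on_def field_differentiable_def
proof
  fix s :: complex assume s: "s \<in> ball 0 1"
  have mem: "(\<lambda>i. t * u i) \<in> cn_ball n" if "t \<in> ball 0 1" for t
  proof (rule cn_ball_scale[OF u(1)])
    have "cmod t * cn_norm n u \<le> cmod t * 1" by (rule mult_left_mono) (use u in auto)
    then show "cmod t * cn_norm n u < 1" using that by simp
  qed
  obtain a :: "nat \<Rightarrow> complex" where a: "\<forall>\<epsilon>>0. \<exists>\<delta>>0. \<forall>w \<in> cn_ball n.
        cn_norm n (\<lambda>i. w i - s * u i) < \<delta> \<longrightarrow>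
        cmod (h w j - h (\<lambda>i. s * u i) j - (\<Sum>i=1..n. a i * (w i - s * u i)))
          \<le> \<epsilon> * cn_norm n (\<lambda>i. w i - s * u i)"
    using h[unfolded holomorphic_ball_map_def, THEN bspec, OF mem[OF s], THEN bspec, OF j] ..
  have nrm: "cn_norm n (\<lambda>i. t * u i - s * u i) = cmod (t - s) * cn_norm n u" for t
    using cn_norm_scale[of n "t - s" u] by (simp add: algebra_simps)
  have nrm_le: "cn_norm n (\<lambda>i. t * u i - s * u i) \<le> cmod (t - s)" for t
    unfolding nrm using mult_left_mono[OF u(2), of "cmod (t - s)"] by simp
  have "((\<lambda>t. h (\<lambda>i. t * u i) j) has_derivative (*) (\<Sum>i=1..n. a i * u i)) (at s within ball 0 1)"
    unfolding has_derivative_within_alt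
  proof (intro conjI allI impI)
    show "bounded_linear ((*) (\<Sum>i=1..n. a i * u i))" by (rule bounded_linear_mult_right)
    fix e :: real assume e: "0 < e"
    with a obtain d where d: "d > 0" "\<And>w. w \<in> cn_ball n \<Longrightarrow>
        cn_norm n (\<lambda>i. w i - s * u i) < d \<Longrightarrow>
        cmod (h w j - h (\<lambda>i. s * u i) j - (\<Sum>i=1..n. a i * (w i - s * u i)))
          \<le> e * cn_norm n (\<lambda>i. w i - s * u i)" by blast
    show "\<exists>d>0. \<forall>t\<in>ball 0 1. norm (t - s) < d \<longrightarrow>
       norm (h (\<lambda>i. t * u i) j - h (\<lambda>i. s * u i) j - (\<Sum>i=1..n. a i * u i) * (t - s))
         \<le> e * norm (t - s)"
    proof (intro exI[of _ d] conjI ballI impI d(1))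
      fix t :: complex assume t: "t \<in> ball 0 1" "norm (t - s) < d"
      have "cmod (h (\<lambda>i. t * u i) j - h (\<lambda>i. s * u i) j - (\<Sum>i=1..n. a i * (t * u i - s * u i)))
          \<le> e * cn_norm n (\<lambda>i. t * u i - s * u i)"
        using d(2)[OF mem[OF t(1)]] nrm_le[of t] t(2) by linarith
      also have "\<dots> \<le> e * cmod (t - s)" by (rule mult_left_mono[OF nrm_le]) (use e in auto)
      finally show "norm (h (\<lambda>i. t * u i) j - h (\<lambda>i. s * u i) j - (\<Sum>i=1..n. a i * u i) * (t - s))
         \<le> e * norm (t - s)"
        by (simp add: sum_distrib_right right_diff_distrib[symmetric] mult.assoc flip: left_diff_distrib)
          (simp add: mult.commute)
    qed
  qed
  then show "\<exists>f'. ((\<lambda>t. h (\<lambda>i. t * u i) j) has_field_derivative f') (at s within ball 0 1)"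
    unfolding has_field_derivative_def by blast
qed

text \<open>Pairing a normalised radial slice of the map with the direction of one of its values gives a
  self-map of the disc, to which the one-variable Schwarz lemma applies.\<close>

lemma radial_slice_disc_map:
  assumes h: "holomorphic_ball_map n N h" and hB: "h \<in> cn_ball n \<rightarrow> cn_ball N"
    and h0: "h (\<lambda>i. 0) = (\<lambda>i. 0)" and z: "z \<in> cn_ball n"
    and z0: "cn_norm n z > 0" and hz0: "cn_norm N (h z) > 0"
  obtains g where "g holomorphic_on ball 0 1" and "g 0 = 0"
    and "\<And>s. cmod s < 1 \<Longrightarrow> cmod (g s) < 1"
    and "g (of_real (cn_norm n z)) = of_real (cn_norm N (h z))"
    and "\<And>s. g s = cn_inner N (h (\<lambda>i. s * (z i / of_real (cn_norm n z))))
                           (\<lambda>i. h z i / of_real (cn_norm N (h z)))"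
proof
  define g where "g = (\<lambda>s. cn_inner N (h (\<lambda>i. s * (z i / of_real (cn_norm n z))))
                           (\<lambda>i. h z i / of_real (cn_norm N (h z))))"
  let ?u = "\<lambda>i. z i / of_real (cn_norm n z)" and ?v = "\<lambda>i. h z i / of_real (cn_norm N (h z))"
  have u: "?u \<in> cn_space n" using cn_ball_space[OF z] by (auto simp: cn_space_def)
  have nu: "cn_norm n ?u = 1"
    using cn_norm_scale[of n "1 / of_real (cn_norm n z)" z] z0 by (simp add: norm_divide)
  have nv: "cn_norm N ?v = 1"
    using cn_norm_scale[of N "1 / of_real (cn_norm N (h z))" "h z"] hz0 by (simp add: norm_divide)
  show "g holomorphic_on ball 0 1"
    unfolding g_def cn_inner_def
    by (intro holomorphic_intros slice_holomorphic[OF h u]) (use hz0 in \<open>auto simp: nu\<close>)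
  show "g 0 = 0" by (simp add: g_def h0 cn_inner_def)
  show "cmod (g s) < 1" if "cmod s < 1" for s
  proof -
    have "(\<lambda>i. s * ?u i) \<in> cn_ball n" by (rule cn_ball_scale[OF u]) (use that in \<open>simp add: nu\<close>)
    then have "cn_norm N (h (\<lambda>i. s * ?u i)) < 1" using hB by (intro cn_ball_norm) auto
    then show ?thesis
      using cn_inner_le[of N "h (\<lambda>i. s * ?u i)" ?v] unfolding g_def nv by linarith
  qed
  have "g (of_real (cn_norm n z)) = cn_inner N (h z) (h z) / of_real (cn_norm N (h z))"
    using z0 by (simp add: g_def cn_inner_def sum_divide_distrib)
  also have "\<dots> = of_real (cn_norm N (h z))" using hz0 by (simp add: cn_inner_self power2_eq_square)
  finally show "g (of_real (cn_norm n z)) = of_real (cn_norm N (h z))" .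
  show "g s = cn_inner N (h (\<lambda>i. s * (z i / of_real (cn_norm n z))))
                         (\<lambda>i. h z i / of_real (cn_norm N (h z)))" for s
    by (simp add: g_def)
qed

lemma ball_map_schwarz:
  assumes h: "holomorphic_ball_map n N h" and hB: "h \<in> cn_ball n \<rightarrow> cn_ball N"
    and h0: "h (\<lambda>i. 0) = (\<lambda>i. 0)" and z: "z \<in> cn_ball n"
  shows "cn_norm N (h z) \<le> cn_norm n z"
proof (cases "cn_norm n z = 0 \<or> cn_norm N (h z) = 0")
  case True
  then show ?thesis using cn_norm_eq_0_iff[OF cn_ball_space[OF z]] by (auto simp: h0)
next
  case False
  then have pos: "cn_norm n z > 0" "cn_norm N (h z) > 0" by (auto simp: less_le)
  obtain g where slice: "g holomorphic_on ball 0 1" "g 0 = 0" "\<And>s. cmod s < 1 \<Longrightarrow> cmod (g s) < 1"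
    "g (of_real (cn_norm n z)) = of_real (cn_norm N (h z))"
    using radial_slice_disc_map[OF h hB h0 z pos] by metis
  have "norm (of_real (cn_norm n z) :: complex) < 1" using cn_ball_norm[OF z] by simp
  from Schwarz_Lemma(1)[OF slice(1,2,3) this] show ?thesis using slice(4) by simp
qed

text \<open>Equality in the Schwarz lemma at one point makes the disc map above a rotation; the
  Cauchy-Schwarz inequality is then sharp along the slice, so the map is linear on it.\<close>

lemma ball_map_schwarz_equality:
  assumes h: "holomorphic_ball_map n N h" and hB: "h \<in> cn_ball n \<rightarrow> cn_ball N"
    and h0: "h (\<lambda>i. 0) = (\<lambda>i. 0)" and z: "z \<in> cn_ball n"
    and eq: "cn_norm N (h z) = cn_norm n z" and t: "cmod t * cn_norm n z < 1"
  shows "h (\<lambda>i. t * z i) = (\<lambda>i. t * h z i)"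
proof (cases "cn_norm n z = 0")
  case True
  then have "z = (\<lambda>i. 0)" using cn_norm_eq_0_iff[OF cn_ball_space[OF z]] by simp
  then show ?thesis by (simp add: h0)
next
  case False
  define r where "r = cn_norm n z"
  have r: "r > 0" using False by (simp add: r_def less_le)
  have pos: "cn_norm n z > 0" "cn_norm N (h z) > 0" using r eq by (auto simp: r_def)
  obtain g where slice: "g holomorphic_on ball 0 1" "g 0 = 0"
    "\<And>s. cmod s < 1 \<Longrightarrow> cmod (g s) < 1" "g (of_real r) = of_real r"
    and g: "\<And>s. g s = cn_inner N (h (\<lambda>i. s * (z i / of_real r))) (\<lambda>i. h z i / of_real r)"
    by (rule radial_slice_disc_map[OF h hB h0 z pos, unfolded eq, folded r_def]) (rule that)
  have r1: "norm (of_real r :: complex) < 1" using cn_ball_norm[OF z] r by (simp add: r_def)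
  have "\<exists>s. norm s < 1 \<and> s \<noteq> 0 \<and> norm (g s) = norm s"
    by (rule exI[of _ "complex_of_real r"]) (use r r1 slice(4) in auto)
  then have "\<exists>\<alpha>. (\<forall>s. norm s < 1 \<longrightarrow> g s = \<alpha> * s) \<and> norm \<alpha> = 1"
    using Schwarz_Lemma(3)[OF slice(1,2,3) r1] by blast
  then obtain \<alpha> where \<alpha>: "\<And>s. norm s < 1 \<Longrightarrow> g s = \<alpha> * s" by blast
  have "\<alpha> = 1" using \<alpha>[OF r1] slice(4) r by simp
  define s where "s = t * of_real r"
  have s: "norm s < 1" using t r by (simp add: s_def norm_mult r_def)
  define y where "y = h (\<lambda>i. t * z i)"
  define v where "v = (\<lambda>i. h z i / of_real r)"
  have tz: "(\<lambda>i. t * z i) \<in> cn_ball n" by (rule cn_ball_scale[OF cn_ball_space[OF z] t])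
  have hz: "h z \<in> cn_ball N" and yB: "y \<in> cn_ball N" using hB z tz by (auto simp: y_def)
  have ny: "cn_norm N y \<le> cmod s"
    using ball_map_schwarz[OF h hB h0 tz] r by (simp add: y_def s_def cn_norm_scale norm_mult r_def)
  have nv: "cn_norm N v = 1"
    using cn_norm_scale[of N "1 / of_real r" "h z"] r eq by (simp add: v_def r_def norm_divide)
  have yv: "cn_inner N y v = s"
    using \<alpha>[OF s] r \<open>\<alpha> = 1\<close> by (simp add: g y_def v_def s_def)
  have "of_real ((cn_norm N (\<lambda>i. y i - s * v i))\<^sup>2)
      = cn_inner N y y - cnj s * cn_inner N y v - s * cnj (cn_inner N y v)
        + s * cnj s * cn_inner N v v"
    unfolding cn_inner_self[symmetric] cn_inner_def
    by (simp add: algebra_simps sum.distrib sum_subtractf sum_distrib_left)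
  also have "\<dots> = of_real ((cn_norm N y)\<^sup>2 - (cmod s)\<^sup>2)"
    by (simp add: yv cn_inner_self nv complex_norm_square[symmetric] mult.commute[of "cnj s"])
  finally have "(cn_norm N (\<lambda>i. y i - s * v i))\<^sup>2 = (cn_norm N y)\<^sup>2 - (cmod s)\<^sup>2"
    using of_real_eq_iff by blast
  moreover have "(cn_norm N y)\<^sup>2 \<le> (cmod s)\<^sup>2" by (rule power_mono[OF ny]) simp
  ultimately have "cn_norm N (\<lambda>i. y i - s * v i) = 0" by (smt (verit) zero_le_power2 zero_eq_power2)
  then have "y i = s * v i" if "i \<in> {1..N}" for i
    using cn_norm_eq_0_imp[of N "\<lambda>i. y i - s * v i" i] that by simp
  then have "y = (\<lambda>i. s * v i)"
    by (intro cn_space_eqI[OF cn_ball_space[OF yB]])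
      (use cn_ball_space[OF hz] in \<open>auto simp: cn_space_def v_def\<close>)
  then show ?thesis using r by (simp add: y_def s_def v_def)
qed

lemma Aut_ballD:
  assumes "\<phi> \<in> Aut_ball n"
  shows "bij_betw \<phi> (cn_ball n) (cn_ball n)" "\<phi> \<in> cn_ball n \<rightarrow> cn_ball n"
    "inv_into (cn_ball n) \<phi> \<in> cn_ball n \<rightarrow> cn_ball n"
    "holomorphic_ball_map n n \<phi>" "holomorphic_ball_map n n (inv_into (cn_ball n) \<phi>)"
    "\<phi> \<in> extensional (cn_ball n)"
  using assms unfolding Aut_ball_def Bij_def
  by (auto simp: bij_betw_def intro: inv_into_into)

lemma Aut_ball_norm:
  assumes \<phi>: "\<phi> \<in> Aut_ball n" and \<phi>0: "\<phi> (\<lambda>i. 0) = (\<lambda>i. 0)" and z: "z \<in> cn_ball n"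
  shows "cn_norm n (\<phi> z) = cn_norm n z"
proof (rule antisym)
  note A = Aut_ballD[OF \<phi>]
  show "cn_norm n (\<phi> z) \<le> cn_norm n z" by (rule ball_map_schwarz[OF A(4,2) \<phi>0 z])
  have inj: "inj_on \<phi> (cn_ball n)" using A(1) by (simp add: bij_betw_def)
  have inv: "inv_into (cn_ball n) \<phi> (\<phi> w) = w" if "w \<in> cn_ball n" for w
    by (rule inv_into_f_f[OF inj that])
  have "inv_into (cn_ball n) \<phi> (\<lambda>i. 0) = (\<lambda>i. 0)" using inv[of "\<lambda>i. 0"] by (simp add: \<phi>0)
  from ball_map_schwarz[OF A(5,3) this, of "\<phi> z"] A(2) z
  show "cn_norm n z \<le> cn_norm n (\<phi> z)" by (auto simp: inv)
qed

text \<open>Being homogeneous of degree one, such an automorphism equals its derivative at the origin.\<close>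

lemma Aut_ball_linear:
  assumes \<phi>: "\<phi> \<in> Aut_ball n" and \<phi>0: "\<phi> (\<lambda>i. 0) = (\<lambda>i. 0)"
  obtains A :: "nat \<Rightarrow> nat \<Rightarrow> complex"
  where "\<And>z j. z \<in> cn_ball n \<Longrightarrow> j \<in> {1..n} \<Longrightarrow> \<phi> z j = (\<Sum>i=1..n. A j i * z i)"
proof -
  note A = Aut_ballD[OF \<phi>]
  have "\<exists>a :: nat \<Rightarrow> complex. \<forall>z \<in> cn_ball n. \<phi> z j = (\<Sum>i=1..n. a i * z i)"
    if j: "j \<in> {1..n}" for j
  proof -
    from A(4)[unfolded holomorphic_ball_map_def, THEN bspec, OF zero_in_cn_ball, THEN bspec, OF j]
    obtain a :: "nat \<Rightarrow> complex"
      where a: "\<And>\<epsilon>. \<epsilon> > 0 \<Longrightarrow> \<exists>\<delta>>0. \<forall>w \<in> cn_ball n. cn_norm n w < \<delta> \<longrightarrow>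
        cmod (\<phi> w j - (\<Sum>i=1..n. a i * w i)) \<le> \<epsilon> * cn_norm n w"
      unfolding \<phi>0 diff_zero by blast
    have "\<phi> z j = (\<Sum>i=1..n. a i * z i)" if z: "z \<in> cn_ball n" for z
    proof -
      have "cmod (\<phi> z j - (\<Sum>i=1..n. a i * z i)) \<le> 0 + e" if e: "e > 0" for e
      proof -
        obtain d where d: "d > 0" "\<And>w. w \<in> cn_ball n \<Longrightarrow> cn_norm n w < d \<Longrightarrow>
          cmod (\<phi> w j - (\<Sum>i=1..n. a i * w i)) \<le> e * cn_norm n w" using a[OF e] by blast
        define t where "t = min 1 (d / 2)"
        have t: "t > 0" "t \<le> 1" "t < d" using d(1) by (auto simp: t_def)
        have nz: "cn_norm n z < 1" by (rule cn_ball_norm[OF z])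
        have nt: "t * cn_norm n z \<le> t" using t nz by (simp add: mult_left_le)
        then have ntd: "t * cn_norm n z < d" using t by linarith
        have tz: "cmod (of_real t) * cn_norm n z < 1"
          using t nz nt by (smt (verit) norm_of_real mult_left_le_one_le cn_norm_nonneg)
        have "\<phi> (\<lambda>i. of_real t * z i) = (\<lambda>i. of_real t * \<phi> z i)"
          by (rule ball_map_schwarz_equality[OF A(4,2) \<phi>0 z Aut_ball_norm[OF \<phi> \<phi>0 z] tz])
        moreover have "cmod (\<phi> (\<lambda>i. of_real t * z i) j - (\<Sum>i=1..n. a i * (of_real t * z i)))
            \<le> e * cn_norm n (\<lambda>i. of_real t * z i)"
          using ntd t by (intro d(2) cn_ball_scale[OF cn_ball_space[OF z] tz]) (simp add: cn_norm_scale)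
        ultimately have "cmod (of_real t * (\<phi> z j - (\<Sum>i=1..n. a i * z i))) \<le> e * (t * cn_norm n z)"
          using t by (simp add: cn_norm_scale algebra_simps sum_distrib_left)
        then have "t * cmod (\<phi> z j - (\<Sum>i=1..n. a i * z i)) \<le> t * (e * cn_norm n z)"
          using t by (simp add: norm_mult mult.left_commute del: mult_le_cancel_left_pos)
        then have "cmod (\<phi> z j - (\<Sum>i=1..n. a i * z i)) \<le> e * cn_norm n z" using t by simp
        also have "\<dots> \<le> e" using e nz by (simp add: mult_left_le)
        finally show ?thesis by simp
      qed
      then have "cmod (\<phi> z j - (\<Sum>i=1..n. a i * z i)) \<le> 0" by (rule field_le_epsilon)
      then show ?thesis by simp
    qed
    then show ?thesis by blast
  qed
  then have "\<forall>j\<in>{1..n}. \<exists>a :: nat \<Rightarrow> complex. \<forall>z \<in> cn_ball n. \<phi> z j = (\<Sum>i=1..n. a i * z i)" ..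
  from bchoice[OF this] obtain A
    where "\<forall>j\<in>{1..n}. \<forall>z \<in> cn_ball n. \<phi> z j = (\<Sum>i=1..n. A j i * z i)" ..
  then show ?thesis using that by blast
qed

section \<open>Intertwining automorphisms and critical points\<close>

text \<open>One constant \<open>K\<close> serves both as Lipschitz bound and as inverse radius of the neighbourhood, so
  that the constants of the components can simply be added.\<close>

lemma holomorphic_ball_map_lipschitz_at:
  assumes h: "holomorphic_ball_map n N h" and c: "c \<in> cn_ball n"
  obtains K where "K \<ge> 0" "\<And>w. w \<in> cn_ball n \<Longrightarrow> K * cn_norm n (\<lambda>i. w i - c i) < 1 \<Longrightarrow>
    cn_norm N (\<lambda>j. h w j - h c j) \<le> K * cn_norm n (\<lambda>i. w i - c i)"
proof -
  have "\<exists>K\<ge>0. \<forall>w \<in> cn_ball n. K * cn_norm n (\<lambda>i. w i - c i) < 1 \<longrightarrow>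
    cmod (h w j - h c j) \<le> K * cn_norm n (\<lambda>i. w i - c i)" if j: "j \<in> {1..N}" for j
  proof -
    from h[unfolded holomorphic_ball_map_def, THEN bspec, OF c, THEN bspec, OF j]
    obtain a :: "nat \<Rightarrow> complex" where "\<forall>\<epsilon>>0. \<exists>\<delta>>0. \<forall>w \<in> cn_ball n.
        cn_norm n (\<lambda>i. w i - c i) < \<delta> \<longrightarrow>
        cmod (h w j - h c j - (\<Sum>i=1..n. a i * (w i - c i))) \<le> \<epsilon> * cn_norm n (\<lambda>i. w i - c i)" ..
    from this[rule_format, of 1] obtain d where d: "d > 0" "\<And>w. w \<in> cn_ball n \<Longrightarrow>
        cn_norm n (\<lambda>i. w i - c i) < d \<Longrightarrow>
        cmod (h w j - h c j - (\<Sum>i=1..n. a i * (w i - c i))) \<le> cn_norm n (\<lambda>i. w i - c i)"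
      by auto
    define K where "K = 1 / d + 1 + (\<Sum>i=1..n. cmod (a i))"
    have Kge: "K \<ge> 1 / d" "K \<ge> 1 + (\<Sum>i=1..n. cmod (a i))"
      using d(1) by (auto simp: K_def sum_nonneg)
    show ?thesis
    proof (intro exI[of _ K] conjI ballI impI)
      show "K \<ge> 0" using d(1) by (simp add: K_def sum_nonneg)
      fix w assume w: "w \<in> cn_ball n" "K * cn_norm n (\<lambda>i. w i - c i) < 1"
      define x where "x = cn_norm n (\<lambda>i. w i - c i)"
      have x: "x \<ge> 0" by (simp add: x_def)
      have "1 / d * x < 1" using mult_right_mono[OF Kge(1) x] w(2) by (simp add: x_def)
      then have xd: "x < d" using d(1) by (simp add: field_simps)
      have "cmod (\<Sum>i=1..n. a i * (w i - c i)) \<le> (\<Sum>i=1..n. cmod (a i) * x)"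
        unfolding x_def
        by (rule order_trans[OF norm_sum], rule sum_mono)
          (auto simp: norm_mult intro!: mult_left_mono cn_norm_component_le[of _ n "\<lambda>i. w i - c i"])
      also have "\<dots> = (\<Sum>i=1..n. cmod (a i)) * x" by (simp add: sum_distrib_right)
      finally have "cmod (h w j - h c j) \<le> x + (\<Sum>i=1..n. cmod (a i)) * x"
        using d(2)[OF w(1)] xd unfolding x_def[symmetric]
        by (smt (verit) norm_triangle_sub)
      also have "\<dots> \<le> K * x" using mult_right_mono[OF Kge(2) x] by (simp add: algebra_simps)
      finally show "cmod (h w j - h c j) \<le> K * cn_norm n (\<lambda>i. w i - c i)" by (simp add: x_def)
    qed
  qed
  then have "\<forall>j\<in>{1..N}. \<exists>K. K \<ge> 0 \<and> (\<forall>w \<in> cn_ball n. K * cn_norm n (\<lambda>i. w i - c i) < 1 \<longrightarrow>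
    cmod (h w j - h c j) \<le> K * cn_norm n (\<lambda>i. w i - c i))" by blast
  from bchoice[OF this] obtain K where K: "\<And>j. j \<in> {1..N} \<Longrightarrow> K j \<ge> 0"
    "\<And>j w. j \<in> {1..N} \<Longrightarrow> w \<in> cn_ball n \<Longrightarrow> K j * cn_norm n (\<lambda>i. w i - c i) < 1 \<Longrightarrow>
      cmod (h w j - h c j) \<le> K j * cn_norm n (\<lambda>i. w i - c i)" by blast
  show ?thesis
  proof
    show "(\<Sum>j=1..N. K j) \<ge> 0" by (rule sum_nonneg) (rule K(1))
    fix w assume w: "w \<in> cn_ball n" "(\<Sum>j=1..N. K j) * cn_norm n (\<lambda>i. w i - c i) < 1"
    have *: "K j * cn_norm n (\<lambda>i. w i - c i) < 1" if "j \<in> {1..N}" for j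
    proof -
      have "K j \<le> (\<Sum>j=1..N. K j)" by (rule member_le_sum) (use that K(1) in auto)
      from mult_right_mono[OF this cn_norm_nonneg[of n "\<lambda>i. w i - c i"]] w(2) show ?thesis by linarith
    qed
    have "cn_norm N (\<lambda>j. h w j - h c j) \<le> (\<Sum>j=1..N. cmod (h w j - h c j))"
      by (rule cn_norm_le_sum)
    also have "\<dots> \<le> (\<Sum>j=1..N. K j * cn_norm n (\<lambda>i. w i - c i))"
      by (rule sum_mono) (rule K(2)[OF _ w(1) *])
    finally show "cn_norm N (\<lambda>j. h w j - h c j) \<le> (\<Sum>j=1..N. K j) * cn_norm n (\<lambda>i. w i - c i)"
      by (simp add: sum_distrib_right)
  qed
qed

text \<open>If \<open>f\<close> vanishes to second order at \<open>0\<close>, so does \<open>\<psi> \<circ> f\<close> up to its value there. Composing with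
  the inverse of \<open>\<gamma>\<close>, which is Lipschitz near \<open>c\<close>, moves this to \<open>c = \<gamma> 0\<close>: the derivative of \<open>f\<close>
  vanishes at \<open>c\<close>. The conclusion expresses this by a quadratic bound on the increment.\<close>

lemma intertwined_critical_point:
  assumes \<gamma>: "\<gamma> \<in> Aut_ball n" and \<psi>: "\<psi> \<in> Aut_ball N"
    and comm: "\<And>z. z \<in> cn_ball n \<Longrightarrow> f (\<gamma> z) = \<psi> (f z)"
    and fB: "f \<in> cn_ball n \<rightarrow> cn_ball N"
    and f2: "\<And>z. z \<in> cn_ball n \<Longrightarrow> cn_norm N (f z) \<le> (cn_norm n z)\<^sup>2"
  defines "c \<equiv> \<gamma> (\<lambda>i. 0)"
  obtains K where "K \<ge> 0" "\<And>w. w \<in> cn_ball n \<Longrightarrow> K * cn_norm n (\<lambda>i. w i - c i) < 1 \<Longrightarrow>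
    cn_norm N (\<lambda>j. f w j - f c j) \<le> K * (cn_norm n (\<lambda>i. w i - c i))\<^sup>2"
proof -
  note A = Aut_ballD[OF \<gamma>] and B = Aut_ballD[OF \<psi>]
  let ?\<gamma>' = "inv_into (cn_ball n) \<gamma>"
  have inj: "inj_on \<gamma> (cn_ball n)" and im: "\<gamma> ` cn_ball n = cn_ball n"
    using A(1) by (auto simp: bij_betw_def)
  have c: "c \<in> cn_ball n" using A(2) unfolding c_def by auto
  have \<gamma>'c: "?\<gamma>' c = (\<lambda>i. 0)" unfolding c_def by (rule inv_into_f_f[OF inj]) simp
  have f0: "f (\<lambda>i. 0) = (\<lambda>i. 0)"
  proof -
    have "f (\<lambda>i. 0) \<in> cn_space N" using fB by (auto dest: cn_ball_space)
    moreover have "cn_norm N (f (\<lambda>i. 0)) = 0"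
      using f2[of "\<lambda>i. 0"] by (simp add: order.antisym)
    ultimately show ?thesis by (simp add: cn_norm_eq_0_iff)
  qed
  have fc: "f c = \<psi> (\<lambda>j. 0)" unfolding c_def by (simp add: comm f0)
  obtain P where P: "P \<ge> 0" "\<And>w. w \<in> cn_ball n \<Longrightarrow> P * cn_norm n (\<lambda>i. w i - c i) < 1 \<Longrightarrow>
    cn_norm n (\<lambda>j. ?\<gamma>' w j - ?\<gamma>' c j) \<le> P * cn_norm n (\<lambda>i. w i - c i)"
    by (rule holomorphic_ball_map_lipschitz_at[OF A(5) c]) (rule that)
  obtain Q where Q: "Q \<ge> 0" "\<And>y. y \<in> cn_ball N \<Longrightarrow> Q * cn_norm N (\<lambda>i. y i - 0) < 1 \<Longrightarrow>
    cn_norm N (\<lambda>j. \<psi> y j - \<psi> (\<lambda>i. 0) j) \<le> Q * cn_norm N (\<lambda>i. y i - 0)"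
    by (rule holomorphic_ball_map_lipschitz_at[OF B(4) zero_in_cn_ball]) (rule that)
  define K where "K = 1 + P + Q * P\<^sup>2"
  show ?thesis
  proof
    show "K \<ge> 0" using P(1) Q(1) by (simp add: K_def)
    fix w assume w: "w \<in> cn_ball n" "K * cn_norm n (\<lambda>i. w i - c i) < 1"
    define x where "x = cn_norm n (\<lambda>i. w i - c i)"
    have x: "x \<ge> 0" by (simp add: x_def)
    have "1 * x \<le> K * x" "P * x \<le> K * x" "(Q * P\<^sup>2) * x \<le> K * x"
      by (rule mult_right_mono[OF _ x]; use P(1) Q(1) in \<open>simp add: K_def\<close>)+
    with w(2) have x1: "x < 1" "P * x < 1" "Q * P\<^sup>2 * x < 1" by (simp_all add: x_def)
    define z where "z = ?\<gamma>' w"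
    have z: "z \<in> cn_ball n" using A(3) w(1) by (auto simp: z_def)
    have \<gamma>z: "\<gamma> z = w" using f_inv_into_f[of w \<gamma> "cn_ball n"] im w(1) by (simp add: z_def)
    have "cn_norm n z \<le> P * x" using P(2)[OF w(1)] x1(2) by (simp add: z_def \<gamma>'c x_def)
    then have "(cn_norm n z)\<^sup>2 \<le> P\<^sup>2 * x\<^sup>2"
      using power_mono[of "cn_norm n z" "P * x" 2] by (simp add: power_mult_distrib)
    then have fz: "cn_norm N (f z) \<le> P\<^sup>2 * x\<^sup>2" using f2[OF z] by linarith
    then have Qf: "Q * cn_norm N (f z) \<le> Q * (P\<^sup>2 * x\<^sup>2)" by (rule mult_left_mono) (rule Q(1))
    also have "\<dots> = (Q * P\<^sup>2 * x) * x" by (simp add: power2_eq_square)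
    also have "\<dots> \<le> 1 * x" by (rule mult_right_mono) (use x1 x in auto)
    also have "\<dots> < 1" using x1 by simp
    finally have "Q * cn_norm N (f z) < 1" .
    moreover have "f z \<in> cn_ball N" using fB z by auto
    ultimately have "cn_norm N (\<lambda>j. \<psi> (f z) j - \<psi> (\<lambda>i. 0) j) \<le> Q * cn_norm N (f z)"
      using Q(2)[of "f z"] by simp
    also have "\<psi> (f z) = f w" using comm[OF z] \<gamma>z by simp
    also have "Q * cn_norm N (f z) \<le> Q * P\<^sup>2 * x\<^sup>2" using Qf by (simp add: mult.assoc)
    also have "\<dots> \<le> K * x\<^sup>2" by (rule mult_right_mono) (use P(1) in \<open>auto simp: K_def\<close>)
    finally show "cn_norm N (\<lambda>j. f w j - f c j) \<le> K * (cn_norm n (\<lambda>i. w i - c i))\<^sup>2"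
      by (simp add: fc x_def)
  qed
qed

lemma derivative_zero_if_quadratic:
  fixes g :: "complex \<Rightarrow> complex"
  assumes g: "(g has_field_derivative d) (at 0)"
    and K: "K \<ge> 0" "\<And>x. K * cmod x < 1 \<Longrightarrow> cmod (g x - g 0) \<le> K * (cmod x)\<^sup>2"
  shows "d = 0"
proof -
  have "(g has_derivative (*) 0) (at 0)"
    unfolding has_derivative_within_alt
  proof (intro conjI allI impI)
    show "bounded_linear ((*) (0::complex))" by (rule bounded_linear_mult_right)
    fix e :: real assume e: "0 < e"
    define r where "r = min (1 / (K + 1)) (e / (K + 1))"
    have r: "r > 0" using e K(1) by (simp add: r_def)
    show "\<exists>r>0. \<forall>y\<in>UNIV. norm (y - 0) < r \<longrightarrow> norm (g y - g 0 - 0 * (y - 0)) \<le> e * norm (y - 0)"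
    proof (intro exI[of _ r] conjI ballI impI r)
      fix y :: complex assume "norm (y - 0) < r"
      then have y: "(K + 1) * cmod y < 1" "(K + 1) * cmod y < e"
        using K(1) by (auto simp: r_def pos_less_divide_eq mult.commute)
      have Ky: "K * cmod y \<le> (K + 1) * cmod y" by (simp add: distrib_right)
      have "cmod (g y - g 0) \<le> (K * cmod y) * cmod y"
        using K(2)[of y] y(1) Ky by (simp add: power2_eq_square)
      also have "\<dots> \<le> e * cmod y" by (rule mult_right_mono) (use y Ky in auto)
      finally show "norm (g y - g 0 - 0 * (y - 0)) \<le> e * norm (y - 0)" by simp
    qed
  qed
  then have "(g has_field_derivative 0) (at 0)" by (simp add: has_field_derivative_def)
  from DERIV_unique[OF g this] show ?thesis .
qed

section \<open>Polynomial maps\<close>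

text \<open>A quadratic remainder, unlike the \<open>\<epsilon>\<close>-\<open>\<delta>\<close> condition in the definition of holomorphy, yields the product
  rule by mere multiplication of constants; polynomials satisfy it by induction.\<close>

definition taylor_remainder :: "nat \<Rightarrow> ((nat \<Rightarrow> complex) \<Rightarrow> complex) \<Rightarrow> bool" where
  "taylor_remainder n p \<longleftrightarrow> (\<forall>z \<in> cn_ball n. \<exists>(a :: nat \<Rightarrow> complex) C. C \<ge> 0 \<and> (\<forall>w \<in> cn_ball n.
     cmod (p w - p z - (\<Sum>i=1..n. a i * (w i - z i))) \<le> C * (cn_norm n (\<lambda>i. w i - z i))\<^sup>2))"

lemma taylor_remainder_const: "taylor_remainder n (\<lambda>z. c)"
  unfolding taylor_remainder_def by (intro ballI exI[of _ "\<lambda>i. 0"] exI[of _ 0]) simp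

lemma taylor_remainder_coordinate:
  assumes "k \<in> {1..n}" shows "taylor_remainder n (\<lambda>z. z k)"
  unfolding taylor_remainder_def
  by (intro ballI exI[of _ "\<lambda>i. if i = k then 1 else 0"] exI[of _ 0])
    (use assms in \<open>simp add: if_distrib[of "\<lambda>x. x * _"] cong: if_cong\<close>)

lemma taylor_remainder_add:
  assumes "taylor_remainder n p" "taylor_remainder n q"
  shows "taylor_remainder n (\<lambda>z. p z + q z)"
  unfolding taylor_remainder_def
proof
  fix z assume z: "z \<in> cn_ball n"
  obtain a C where a: "C \<ge> 0" "\<And>w. w \<in> cn_ball n \<Longrightarrow>
     cmod (p w - p z - (\<Sum>i=1..n. a i * (w i - z i))) \<le> C * (cn_norm n (\<lambda>i. w i - z i))\<^sup>2"
    using assms(1) z unfolding taylor_remainder_def by blast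
  obtain b D where b: "D \<ge> 0" "\<And>w. w \<in> cn_ball n \<Longrightarrow>
     cmod (q w - q z - (\<Sum>i=1..n. b i * (w i - z i))) \<le> D * (cn_norm n (\<lambda>i. w i - z i))\<^sup>2"
    using assms(2) z unfolding taylor_remainder_def by blast
  have "cmod (p w + q w - (p z + q z) - (\<Sum>i=1..n. (a i + b i) * (w i - z i)))
      \<le> (C + D) * (cn_norm n (\<lambda>i. w i - z i))\<^sup>2" if "w \<in> cn_ball n" for w
  proof -
    have "p w + q w - (p z + q z) - (\<Sum>i=1..n. (a i + b i) * (w i - z i))
       = (p w - p z - (\<Sum>i=1..n. a i * (w i - z i))) + (q w - q z - (\<Sum>i=1..n. b i * (w i - z i)))"
      by (simp add: distrib_right sum.distrib)
    then show ?thesis using norm_triangle_le[OF add_mono[OF a(2)[OF that] b(2)[OF that]]]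
      by (simp only: distrib_right)
  qed
  then show "\<exists>a C. C \<ge> 0 \<and> (\<forall>w\<in>cn_ball n.
      cmod (p w + q w - (p z + q z) - (\<Sum>i=1..n. a i * (w i - z i)))
        \<le> C * (cn_norm n (\<lambda>i. w i - z i))\<^sup>2)"
    using add_nonneg_nonneg[OF a(1) b(1)]
    by (intro exI[of _ "\<lambda>i. a i + b i"] exI[of _ "C + D"] conjI ballI)
qed

lemma cn_norm_diff_le_2:
  assumes "z \<in> cn_ball n" "w \<in> cn_ball n"
  shows "cn_norm n (\<lambda>i. w i - z i) \<le> 2"
proof -
  have "cn_norm n (\<lambda>i. w i - z i) \<le> L2_set (\<lambda>i. cmod (w i) + cmod (z i)) {1..n}"
    unfolding cn_norm_def by (rule L2_set_mono) (auto intro: norm_triangle_ineq4)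
  also have "\<dots> \<le> cn_norm n w + cn_norm n z"
    unfolding cn_norm_def by (rule L2_set_triangle_ineq)
  also have "\<dots> \<le> 2" using assms by (auto dest!: cn_ball_norm)
  finally show ?thesis .
qed

lemma taylor_remainder_mult:
  assumes "taylor_remainder n p" "taylor_remainder n q"
  shows "taylor_remainder n (\<lambda>z. p z * q z)"
  unfolding taylor_remainder_def
proof
  fix z assume z: "z \<in> cn_ball n"
  obtain a C where a: "C \<ge> 0" "\<And>w. w \<in> cn_ball n \<Longrightarrow>
     cmod (p w - p z - (\<Sum>i=1..n. a i * (w i - z i))) \<le> C * (cn_norm n (\<lambda>i. w i - z i))\<^sup>2"
    using assms(1) z unfolding taylor_remainder_def by blast
  obtain b D where b: "D \<ge> 0" "\<And>w. w \<in> cn_ball n \<Longrightarrow>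
     cmod (q w - q z - (\<Sum>i=1..n. b i * (w i - z i))) \<le> D * (cn_norm n (\<lambda>i. w i - z i))\<^sup>2"
    using assms(2) z unfolding taylor_remainder_def by blast
  have lip: "cmod (u w - u z) \<le> (2 * R + (\<Sum>i=1..n. cmod (e i))) * cn_norm n (\<lambda>i. w i - z i)"
    if w: "w \<in> cn_ball n" and R: "R \<ge> 0"
      "cmod (u w - u z - (\<Sum>i=1..n. e i * (w i - z i))) \<le> R * (cn_norm n (\<lambda>i. w i - z i))\<^sup>2"
    for u :: "(nat \<Rightarrow> complex) \<Rightarrow> complex" and e R w
  proof -
    define x where "x = cn_norm n (\<lambda>i. w i - z i)"
    have "cmod (\<Sum>i=1..n. e i * (w i - z i)) \<le> (\<Sum>i=1..n. cmod (e i) * x)"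
      unfolding x_def
      by (rule order_trans[OF norm_sum], rule sum_mono)
        (auto simp: norm_mult intro!: mult_left_mono cn_norm_component_le[of _ n "\<lambda>i. w i - z i"])
    moreover have "R * x\<^sup>2 \<le> R * (2 * x)"
      using cn_norm_diff_le_2[OF z w] R(1)
      by (auto simp: x_def power2_eq_square intro!: mult_left_mono mult_right_mono)
    moreover have "cmod (u w - u z) \<le> cmod (\<Sum>i=1..n. e i * (w i - z i)) + R * x\<^sup>2"
      using norm_triangle_sub[of "u w - u z" "\<Sum>i=1..n. e i * (w i - z i)"] R(2)
      unfolding x_def by linarith
    ultimately have "cmod (u w - u z) \<le> (\<Sum>i=1..n. cmod (e i) * x) + R * (2 * x)" by linarith
    then show ?thesis by (simp add: x_def distrib_right sum_distrib_right mult.assoc mult.left_commute)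
  qed
  define S where "S = (2 * C + (\<Sum>i=1..n. cmod (a i)))"
  define T where "T = (2 * D + (\<Sum>i=1..n. cmod (b i)))"
  define K where "K = C * cmod (q z) + cmod (p z) * D + S * T"
  have S: "S \<ge> 0" and T: "T \<ge> 0" using a(1) b(1) by (auto simp: S_def T_def sum_nonneg)
  have "cmod (p w * q w - p z * q z - (\<Sum>i=1..n. (a i * q z + p z * b i) * (w i - z i)))
      \<le> K * (cn_norm n (\<lambda>i. w i - z i))\<^sup>2" if w: "w \<in> cn_ball n" for w
  proof -
    define x where "x = cn_norm n (\<lambda>i. w i - z i)"
    define A where "A = p w - p z - (\<Sum>i=1..n. a i * (w i - z i))"
    define B where "B = q w - q z - (\<Sum>i=1..n. b i * (w i - z i))"
    have "(\<Sum>i=1..n. (a i * q z + p z * b i) * (w i - z i))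
        = (\<Sum>i=1..n. a i * (w i - z i)) * q z + p z * (\<Sum>i=1..n. b i * (w i - z i))"
      by (simp add: sum_distrib_left sum_distrib_right flip: sum.distrib)
        (simp add: algebra_simps)
    then have "p w * q w - p z * q z - (\<Sum>i=1..n. (a i * q z + p z * b i) * (w i - z i))
        = A * q z + p z * B + (p w - p z) * (q w - q z)"
      by (simp add: A_def B_def algebra_simps)
    also have "cmod \<dots> \<le> cmod A * cmod (q z) + cmod (p z) * cmod B + cmod (p w - p z) * cmod (q w - q z)"
      by (intro norm_triangle_mono) (simp_all add: norm_mult)
    also have "\<dots> \<le> (C * x\<^sup>2) * cmod (q z) + cmod (p z) * (D * x\<^sup>2) + (S * x) * (T * x)"
      unfolding A_def B_def x_def S_def T_def
      by (intro add_mono mult_mono lip w a b) (use a(1) b(1) in \<open>auto intro!: mult_nonneg_nonneg add_nonneg_nonneg sum_nonneg\<close>)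
    also have "\<dots> = K * x\<^sup>2" by (simp add: K_def algebra_simps power2_eq_square)
    finally show ?thesis by (simp add: x_def)
  qed
  moreover have "K \<ge> 0" using S T a(1) b(1) by (simp add: K_def)
  ultimately show "\<exists>a C. C \<ge> 0 \<and> (\<forall>w\<in>cn_ball n.
      cmod (p w * q w - p z * q z - (\<Sum>i=1..n. a i * (w i - z i)))
        \<le> C * (cn_norm n (\<lambda>i. w i - z i))\<^sup>2)"
    by (intro exI[of _ "\<lambda>i. a i * q z + p z * b i"] exI[of _ K] conjI ballI)
qed

lemma taylor_remainder_power: "taylor_remainder n p \<Longrightarrow> taylor_remainder n (\<lambda>z. p z ^ k)"
  by (induction k) (simp_all add: taylor_remainder_const taylor_remainder_mult)

lemma taylor_remainder_prod:
  "(\<And>i. i \<in> I \<Longrightarrow> taylor_remainder n (p i)) \<Longrightarrow> taylor_remainder n (\<lambda>z. \<Prod>i\<in>I. p i z)"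
  by (induction I rule: infinite_finite_induct)
    (simp_all add: taylor_remainder_const taylor_remainder_mult)

lemma taylor_remainder_sum:
  "(\<And>i. i \<in> I \<Longrightarrow> taylor_remainder n (p i)) \<Longrightarrow> taylor_remainder n (\<lambda>z. \<Sum>i\<in>I. p i z)"
  by (induction I rule: infinite_finite_induct)
    (simp_all add: taylor_remainder_const taylor_remainder_add)

lemma taylor_remainder_imp_holomorphic:
  assumes "\<And>j. j \<in> {1..N} \<Longrightarrow> taylor_remainder n (\<lambda>z. f z j)"
  shows "holomorphic_ball_map n N f"
  unfolding holomorphic_ball_map_def
proof (intro ballI)
  fix z j assume z: "z \<in> cn_ball n" and j: "j \<in> {1..N}"
  obtain a C where a: "C \<ge> 0" "\<And>w. w \<in> cn_ball n \<Longrightarrow>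
     cmod (f w j - f z j - (\<Sum>i=1..n. a i * (w i - z i))) \<le> C * (cn_norm n (\<lambda>i. w i - z i))\<^sup>2"
    using assms[OF j] z unfolding taylor_remainder_def by blast
  have "\<exists>\<delta>>0. \<forall>w \<in> cn_ball n. cn_norm n (\<lambda>i. w i - z i) < \<delta> \<longrightarrow>
      cmod (f w j - f z j - (\<Sum>i=1..n. a i * (w i - z i))) \<le> \<epsilon> * cn_norm n (\<lambda>i. w i - z i)"
    if \<epsilon>: "\<epsilon> > 0" for \<epsilon>
  proof (intro exI[of _ "\<epsilon> / (C + 1)"] conjI ballI impI)
    show "\<epsilon> / (C + 1) > 0" using \<epsilon> a(1) by simp
    fix w assume w: "w \<in> cn_ball n" and lt: "cn_norm n (\<lambda>i. w i - z i) < \<epsilon> / (C + 1)"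
    define x where "x = cn_norm n (\<lambda>i. w i - z i)"
    have x: "x \<ge> 0" by (simp add: x_def)
    have "(C + 1) * x < \<epsilon>" using lt a(1) by (simp add: x_def pos_less_divide_eq mult.commute)
    then have "C * x \<le> \<epsilon>" using x by (simp add: distrib_right)
    from mult_right_mono[OF this x] a(2)[OF w]
    show "cmod (f w j - f z j - (\<Sum>i=1..n. a i * (w i - z i))) \<le> \<epsilon> * cn_norm n (\<lambda>i. w i - z i)"
      by (simp add: x_def power2_eq_square mult.assoc)
  qed
  then show "\<exists>a. \<forall>\<epsilon>>0. \<exists>\<delta>>0. \<forall>w \<in> cn_ball n. cn_norm n (\<lambda>i. w i - z i) < \<delta> \<longrightarrow>
      cmod (f w j - f z j - (\<Sum>i=1..n. a i * (w i - z i))) \<le> \<epsilon> * cn_norm n (\<lambda>i. w i - z i)"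
    by blast
qed

lemma holomorphic_ball_map_cong:
  assumes "\<And>z. z \<in> cn_ball n \<Longrightarrow> f z = g z"
  shows "holomorphic_ball_map n N f \<longleftrightarrow> holomorphic_ball_map n N g"
  unfolding holomorphic_ball_map_def by (simp add: assms cong: ball_cong)

definition polynomial_function :: "nat \<Rightarrow> ((nat \<Rightarrow> complex) \<Rightarrow> complex) \<Rightarrow> bool" where
  "polynomial_function n p \<longleftrightarrow> (\<exists>(A :: (nat \<Rightarrow> nat) set) (c :: (nat \<Rightarrow> nat) \<Rightarrow> complex). finite A \<and>
     (\<forall>z. p z = (\<Sum>\<alpha>\<in>A. c \<alpha> * (\<Prod>i=1..n. z i ^ \<alpha> i))))"

lemma polynomial_function_cmult:
  assumes "polynomial_function n p" shows "polynomial_function n (\<lambda>z. a * p z)"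
proof -
  obtain A c where "finite A" "\<And>z. p z = (\<Sum>\<alpha>\<in>A. c \<alpha> * (\<Prod>i=1..n. z i ^ \<alpha> i))"
    using assms unfolding polynomial_function_def by blast
  then show ?thesis unfolding polynomial_function_def
    by (intro exI[of _ A] exI[of _ "\<lambda>\<alpha>. a * c \<alpha>"]) (simp add: sum_distrib_left mult.assoc)
qed

lemma polynomial_function_add:
  assumes "polynomial_function n p" "polynomial_function n q"
  shows "polynomial_function n (\<lambda>z. p z + q z)"
proof -
  obtain A c where A: "finite A" "\<And>z. p z = (\<Sum>\<alpha>\<in>A. c \<alpha> * (\<Prod>i=1..n. z i ^ \<alpha> i))"
    using assms(1) unfolding polynomial_function_def by blast
  obtain B d where B: "finite B" "\<And>z. q z = (\<Sum>\<alpha>\<in>B. d \<alpha> * (\<Prod>i=1..n. z i ^ \<alpha> i))"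
    using assms(2) unfolding polynomial_function_def by blast
  define e where "e = (\<lambda>\<alpha>. (if \<alpha> \<in> A then c \<alpha> else 0) + (if \<alpha> \<in> B then d \<alpha> else 0))"
  have "p z + q z = (\<Sum>\<alpha>\<in>A \<union> B. e \<alpha> * (\<Prod>i=1..n. z i ^ \<alpha> i))" for z
  proof -
    have "p z = (\<Sum>\<alpha>\<in>A \<union> B. (if \<alpha> \<in> A then c \<alpha> else 0) * (\<Prod>i=1..n. z i ^ \<alpha> i))"
      unfolding A(2) by (rule sum.mono_neutral_cong_left) (use A(1) B(1) in auto)
    moreover have "q z = (\<Sum>\<alpha>\<in>A \<union> B. (if \<alpha> \<in> B then d \<alpha> else 0) * (\<Prod>i=1..n. z i ^ \<alpha> i))"
      unfolding B(2) by (rule sum.mono_neutral_cong_left) (use A(1) B(1) in auto)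
    ultimately show ?thesis by (simp add: e_def distrib_right sum.distrib)
  qed
  then show ?thesis unfolding polynomial_function_def using A(1) B(1) by blast
qed

lemma polynomial_ball_map_holomorphic:
  assumes "polynomial_ball_map n N f"
  shows "holomorphic_ball_map n N f"
proof -
  have "\<forall>j\<in>{1..N}. \<exists>p. taylor_remainder n p \<and> (\<forall>z\<in>cn_ball n. f z j = p z)"
  proof
    fix j assume "j \<in> {1..N}"
    then obtain A c where "\<forall>z \<in> cn_ball n. f z j = (\<Sum>\<alpha>\<in>A. c \<alpha> * (\<Prod>i=1..n. z i ^ \<alpha> i))"
      using assms unfolding polynomial_ball_map_def by blast
    then show "\<exists>p. taylor_remainder n p \<and> (\<forall>z\<in>cn_ball n. f z j = p z)"
      by (intro exI[of _ "\<lambda>z. \<Sum>\<alpha>\<in>A. c \<alpha> * (\<Prod>i=1..n. z i ^ \<alpha> i)"] conjI taylor_remainder_sum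
        taylor_remainder_mult taylor_remainder_const taylor_remainder_prod taylor_remainder_power
        taylor_remainder_coordinate)
  qed
  from bchoice[OF this] obtain p where p: "\<And>j. j \<in> {1..N} \<Longrightarrow> taylor_remainder n (p j)"
    "\<And>j z. j \<in> {1..N} \<Longrightarrow> z \<in> cn_ball n \<Longrightarrow> f z j = p j z" by blast
  have "taylor_remainder n (\<lambda>z. f z j)" if "j \<in> {1..N}" for j
    using p(1)[OF that] unfolding taylor_remainder_def by (simp add: p(2)[OF that] cong: ball_cong)
  then show ?thesis by (rule taylor_remainder_imp_holomorphic)
qed

lemma continuous_on_cn_norm: "continuous_on UNIV (cn_norm n)"
  unfolding cn_norm_def L2_set_def by (intro continuous_intros continuous_on_product_coordinates)

lemma compact_cn_closed_ball: "compact {z \<in> cn_space n. cn_norm n z \<le> 1}"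
proof -
  have "compactin (product_topology (\<lambda>i::nat. euclidean) UNIV) (PiE UNIV (\<lambda>i. cball (0::complex) 1))"
    by (simp add: compactin_PiE)
  then have cp: "compact (PiE UNIV (\<lambda>i::nat. cball (0::complex) 1))"
    by (simp add: euclidean_product_topology)
  have "closed {z :: nat \<Rightarrow> complex. z i = 0}" for i
    by (intro closed_Collect_eq continuous_on_product_coordinates continuous_on_const)
  then have "closed (\<Inter>i\<in>-{1..n}. {z :: nat \<Rightarrow> complex. z i = 0})" by blast
  moreover have "closed {z. cn_norm n z \<le> 1}"
    by (intro closed_Collect_le continuous_on_cn_norm continuous_on_const)
  ultimately have "closed ((\<Inter>i\<in>-{1..n}. {z :: nat \<Rightarrow> complex. z i = 0}) \<inter> {z. cn_norm n z \<le> 1})" by blast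
  also have "(\<Inter>i\<in>-{1..n}. {z :: nat \<Rightarrow> complex. z i = 0}) \<inter> {z. cn_norm n z \<le> 1}
      = {z \<in> cn_space n. cn_norm n z \<le> 1}" by (auto simp: cn_space_def)
  finally have cl: "closed {z \<in> cn_space n. cn_norm n z \<le> 1}" .
  have "cmod (z i) \<le> 1" if "z \<in> cn_space n" "cn_norm n z \<le> 1" for z i
    using that cn_norm_component_le[of i n z] by (cases "i \<in> {1..n}") (auto simp: cn_space_def)
  then have "{z \<in> cn_space n. cn_norm n z \<le> 1} \<subseteq> PiE UNIV (\<lambda>i. cball 0 1)" by auto
  then have "{z \<in> cn_space n. cn_norm n z \<le> 1}
    = PiE UNIV (\<lambda>i. cball 0 1) \<inter> {z \<in> cn_space n. cn_norm n z \<le> 1}" by blast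
  then show ?thesis using compact_Int_closed[OF cp cl] by simp
qed

text \<open>A point of the sphere is not mapped into a compact subset of the open ball, so the preimage of
  such a set in the open ball coincides with its preimage in the compact closed ball.\<close>

lemma proper_if_sphere_to_sphere:
  assumes f: "f \<in> cn_ball n \<rightarrow> cn_ball N" "holomorphic_ball_map n N f"
    and cont: "continuous_on UNIV f"
    and sphere: "\<And>z. z \<in> cn_space n \<Longrightarrow> cn_norm n z = 1 \<Longrightarrow> cn_norm N (f z) = 1"
  shows "proper_holomorphic_ball_map n N f"
  unfolding proper_holomorphic_ball_map_def
proof (intro conjI allI impI f)
  fix K assume K: "K \<subseteq> cn_ball N \<and> compact K"
  have "cn_norm n z < 1" if "z \<in> cn_space n" "cn_norm n z \<le> 1" "f z \<in> K" for z
    using sphere[OF that(1)] that K cn_ball_norm[of "f z" N] by fastforce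
  then have "f -` K \<inter> cn_ball n = {z \<in> cn_space n. cn_norm n z \<le> 1} \<inter> f -` K"
    by (auto simp: cn_ball_def)
  moreover have "closed (f -` K)"
    using cont K by (auto intro: closed_vimage compact_imp_closed)
  ultimately show "compact (f -` K \<inter> cn_ball n)"
    using compact_Int_closed[OF compact_cn_closed_ball] by metis
qed

section \<open>The components of the map\<close>

text \<open>Monomials are indexed by words in the letters \<open>{1..n}\<close>, that is, by the standard basis of a tensor
  power, rather than by multi-indices: the sum of their squared moduli over all words of length \<open>d\<close> is
  then \<open>\<parallel>z\<parallel>\<close> to the power \<open>2 d\<close> without multinomial coefficients.\<close>

definition wmon :: "(nat \<Rightarrow> complex) \<Rightarrow> nat list \<Rightarrow> complex" where
  "wmon z w = prod_list (map z w)"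

lemma wmon_Nil [simp]: "wmon z [] = 1" and wmon_Cons [simp]: "wmon z (k # w) = z k * wmon z w"
  by (simp_all add: wmon_def)

lemma wmon_map: "wmon z (map \<sigma> w) = wmon (\<lambda>i. z (\<sigma> i)) w"
  by (simp add: wmon_def comp_def)

lemma wmon_replicate [simp]: "wmon z (replicate d i) = z i ^ d"
  by (induction d) auto

lemma cmod_wmon_uminus: "cmod (wmon (\<lambda>i. - z i) w) = cmod (wmon z w)"
  by (induction w) (auto simp: norm_mult)

lemma continuous_on_wmon: "continuous_on UNIV (\<lambda>z. wmon z w)"
  by (induction w) (auto intro!: continuous_intros)

lemma polynomial_function_wmon:
  assumes "set w \<subseteq> {1..n}" shows "polynomial_function n (\<lambda>z. wmon z w)"
proof -
  have "wmon z w = (\<Prod>i=1..n. z i ^ count_list w i)" for z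
    using assms
  proof (induction w)
    case (Cons k w)
    have "(\<Prod>i=1..n. z i ^ count_list (k # w) i)
        = (\<Prod>i=1..n. (if i = k then z k else 1) * z i ^ count_list w i)"
      by (rule prod.cong) auto
    also have "\<dots> = z k * (\<Prod>i=1..n. z i ^ count_list w i)"
      using Cons.prems by (simp add: prod.distrib)
    finally show ?case using Cons by simp
  qed simp
  then show ?thesis
    unfolding polynomial_function_def by (intro exI[of _ "{count_list w}"] exI[of _ "\<lambda>_. 1"]) simp
qed

definition words :: "nat \<Rightarrow> nat \<Rightarrow> nat list set" where
  "words n d = {w. set w \<subseteq> {1..n} \<and> length w = d}"

lemma finite_words: "finite (words n d)"
  unfolding words_def by (rule finite_lists_length_eq) simp

lemma sum_words: "(\<Sum>w\<in>words n d. (cmod (wmon z w))\<^sup>2) = ((cn_norm n z)\<^sup>2) ^ d"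
proof (induction d)
  case 0
  have "words n 0 = {[]}" by (auto simp: words_def)
  then show ?case by simp
next
  case (Suc d)
  have eq: "words n (Suc d) = (\<lambda>(k, w). k # w) ` ({1..n} \<times> words n d)"
    by (auto simp: words_def image_iff length_Suc_conv)
  have "(\<Sum>w\<in>words n (Suc d). (cmod (wmon z w))\<^sup>2)
      = (\<Sum>(k, w)\<in>{1..n} \<times> words n d. (cmod (z k))\<^sup>2 * (cmod (wmon z w))\<^sup>2)"
    unfolding eq by (subst sum.reindex) (auto simp: inj_on_def norm_mult power_mult_distrib intro!: sum.cong)
  also have "\<dots> = (cn_norm n z)\<^sup>2 * (\<Sum>w\<in>words n d. (cmod (wmon z w))\<^sup>2)"
    by (simp add: cn_norm_power2 sum_product sum.cartesian_product)
  finally show ?case by (simp add: Suc)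
qed

text \<open>With all words of lengths \<open>2\<close>, \<open>3\<close> and \<open>D\<close> as components, each divided by \<open>sqrt 3\<close>, the map is a
  juxtaposition of tensor powers. For each \<open>i\<close> the pair \<open>z\<^sub>i\<^sup>2\<close>, \<open>z\<^sub>i\<^sup>3\<close> is rotated into
  \<open>(z\<^sub>i\<^sup>2 - z\<^sub>i\<^sup>3) / sqrt 2\<close> and \<open>(z\<^sub>i\<^sup>2 + z\<^sub>i\<^sup>3) / sqrt 2\<close>; the first is kept (\<open>Minus i\<close>), the
  second is multiplied by every coordinate (\<open>Plus i k\<close>). The words in \<open>W\<close> are multiplied by every
  coordinate as well, which prolongs them by one letter; all others are kept.\<close>

datatype idx = Word "nat list" | Minus nat | Plus nat nat

fun component :: "idx \<Rightarrow> (nat \<Rightarrow> complex) \<Rightarrow> complex" where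
  "component (Word w) z = wmon z w / of_real (sqrt 3)"
| "component (Minus i) z = (z i ^ 2 - z i ^ 3) / of_real (sqrt 6)"
| "component (Plus i k) z = (z i ^ 2 + z i ^ 3) * z k / of_real (sqrt 6)"

fun relabel :: "(nat \<Rightarrow> nat) \<Rightarrow> idx \<Rightarrow> idx" where
  "relabel \<sigma> (Word w) = Word (map \<sigma> w)"
| "relabel \<sigma> (Minus i) = Minus (\<sigma> i)"
| "relabel \<sigma> (Plus i k) = Plus (\<sigma> i) (\<sigma> k)"

lemma component_relabel: "component (relabel \<sigma> \<iota>) z = component \<iota> (\<lambda>i. z (\<sigma> i))"
  by (cases \<iota>) (auto simp: wmon_map)

lemma inj_relabel: "inj \<sigma> \<Longrightarrow> inj (relabel \<sigma>)"
proof (rule injI)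
  fix \<iota> \<kappa> assume "inj \<sigma>" "relabel \<sigma> \<iota> = relabel \<sigma> \<kappa>"
  then show "\<iota> = \<kappa>" by (cases \<iota>; cases \<kappa>) (auto simp: inj_map_eq_map dest: injD)
qed

lemma continuous_on_component: "continuous_on UNIV (component \<iota>)"
  by (cases \<iota>) (auto intro!: continuous_intros continuous_on_wmon continuous_on_product_coordinates)

definition word_indices :: "nat \<Rightarrow> nat \<Rightarrow> nat list set \<Rightarrow> nat list set" where
  "word_indices n D W = (words n 2 - replicate 2 ` {1..n}) \<union> (words n 3 - replicate 3 ` {1..n})
     \<union> (words n D - W) \<union> (\<lambda>(k, w). k # w) ` ({1..n} \<times> W)"

definition indices :: "nat \<Rightarrow> nat \<Rightarrow> nat list set \<Rightarrow> idx set" where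
  "indices n D W = Word ` word_indices n D W \<union> Minus ` {1..n}
     \<union> (\<lambda>(i, k). Plus i k) ` ({1..n} \<times> {1..n})"

text \<open>The factor of \<open>1 - \<parallel>z\<parallel>\<^sup>2\<close> by which the squared norm of the map falls short of that of the
  juxtaposed tensor powers.\<close>

definition defect :: "nat \<Rightarrow> nat list set \<Rightarrow> (nat \<Rightarrow> complex) \<Rightarrow> real" where
  "defect n W z = (\<Sum>i=1..n. (cmod (z i ^ 2 + z i ^ 3))\<^sup>2) / 6 + (\<Sum>w\<in>W. (cmod (wmon z w))\<^sup>2) / 3"

lemma defect_nonneg: "defect n W z \<ge> 0"
  by (simp add: defect_def sum_nonneg)

lemma word_indices_letters: "W \<subseteq> words n D \<Longrightarrow> w \<in> word_indices n D W \<Longrightarrow> set w \<subseteq> {1..n}"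
  by (fastforce simp: word_indices_def words_def)

lemma finite_indices:
  assumes "W \<subseteq> words n D" shows "finite (indices n D W)"
  using finite_subset[OF assms finite_words] unfolding indices_def word_indices_def
  by (auto simp: finite_words)

lemma polynomial_function_component:
  assumes "W \<subseteq> words n D" "\<iota> \<in> indices n D W"
  shows "polynomial_function n (component \<iota>)"
  using assms(2) unfolding indices_def
proof (elim UnE imageE, goal_cases)
  case (1 w)
  then have "polynomial_function n (\<lambda>z. (1 / of_real (sqrt 3)) * wmon z w)"
    by (intro polynomial_function_cmult polynomial_function_wmon word_indices_letters[OF assms(1)])
  moreover have "component \<iota> = (\<lambda>z. (1 / of_real (sqrt 3)) * wmon z w)" using 1 by (simp add: fun_eq_iff)
  ultimately show ?case by simp
next
  case (2 i)
  then have "polynomial_function n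
      (\<lambda>z. (1 / of_real (sqrt 6)) * wmon z [i, i] + (- 1 / of_real (sqrt 6)) * wmon z [i, i, i])"
    by (intro polynomial_function_add polynomial_function_cmult polynomial_function_wmon) auto
  moreover have "component \<iota>
      = (\<lambda>z. (1 / of_real (sqrt 6)) * wmon z [i, i] + (- 1 / of_real (sqrt 6)) * wmon z [i, i, i])"
    using 2 by (simp add: fun_eq_iff power2_eq_square power3_eq_cube diff_divide_distrib)
  ultimately show ?case by simp
next
  case (3 p)
  obtain i k where p: "p = (i, k)" by (cases p)
  have "polynomial_function n
      (\<lambda>z. (1 / of_real (sqrt 6)) * wmon z [i, i, k] + (1 / of_real (sqrt 6)) * wmon z [i, i, i, k])"
    using 3 p by (intro polynomial_function_add polynomial_function_cmult polynomial_function_wmon) auto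
  moreover have "component \<iota>
      = (\<lambda>z. (1 / of_real (sqrt 6)) * wmon z [i, i, k] + (1 / of_real (sqrt 6)) * wmon z [i, i, i, k])"
    using 3 p by (simp add: fun_eq_iff power2_eq_square power3_eq_cube add_divide_distrib algebra_simps)
  ultimately show ?case by simp
qed

lemma cmod_parallelogram:
  "(cmod (a - b))\<^sup>2 + (cmod (a + b))\<^sup>2 = 2 * (cmod a)\<^sup>2 + 2 * (cmod b)\<^sup>2"
  unfolding cmod_power2 by (simp add: power2_eq_square algebra_simps)

text \<open>The hypothesis on \<open>D\<close> makes the lengths \<open>2\<close>, \<open>3\<close>, \<open>D\<close> and \<open>D + 1\<close> distinct, so that no component is
  counted twice. The rotated pairs recombine by the parallelogram identity.\<close>

lemma sum_component:
  assumes D: "4 \<le> D" and W: "W \<subseteq> words n D"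
  defines "r \<equiv> \<lambda>z. (cn_norm n z)\<^sup>2"
  shows "(\<Sum>\<iota>\<in>indices n D W. (cmod (component \<iota> z))\<^sup>2)
     = (r z ^ 2 + r z ^ 3 + r z ^ D) / 3 - (1 - r z) * defect n W z"
proof -
  define m where "m = (\<lambda>w. (cmod (wmon z w))\<^sup>2)"
  define M where "M = (\<Sum>w\<in>W. m w)"
  define S where "S = (\<Sum>i=1..n. (cmod (z i ^ 2 + z i ^ 3))\<^sup>2)"
  define T where "T = (\<Sum>i=1..n. (cmod (z i ^ 2 - z i ^ 3))\<^sup>2)"
  define P where "P = (\<lambda>d. \<Sum>i=1..n. (cmod (z i ^ d))\<^sup>2)"
  note fin = finite_words[of n] finite_subset[OF W finite_words]
  have ST: "T + S = 2 * P 2 + 2 * P 3"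
    unfolding S_def T_def P_def sum_distrib_left sum.distrib[symmetric]
    by (rule sum.cong) (simp_all add: cmod_parallelogram)
  have powers: "(\<Sum>w\<in>words n d - replicate d ` {1..n}. m w) = r z ^ d - P d" if "d > 0" for d
  proof -
    have inj: "inj_on (replicate d) {1..n}" using that by (auto simp: inj_on_def)
    have "(\<Sum>w\<in>replicate d ` {1..n}. m w) = P d"
      by (subst sum.reindex[OF inj]) (simp add: m_def P_def)
    moreover have "replicate d ` {1..n} \<subseteq> words n d" by (auto simp: words_def)
    ultimately show ?thesis
      using sum_words[of z n d] by (simp add: sum_diff fin m_def r_def)
  qed
  have rest: "(\<Sum>w\<in>words n D - W. m w) = r z ^ D - M"
    using sum_words[of z n D] W by (simp add: sum_diff fin m_def r_def M_def)
  have cons: "(\<Sum>w\<in>(\<lambda>(k, w). k # w) ` ({1..n} \<times> W). m w) = r z * M"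
  proof -
    have "(\<Sum>w\<in>(\<lambda>(k, w). k # w) ` ({1..n} \<times> W). m w) = (\<Sum>(k, w)\<in>{1..n} \<times> W. (cmod (z k))\<^sup>2 * m w)"
      by (subst sum.reindex) (auto simp: inj_on_def norm_mult power_mult_distrib m_def intro!: sum.cong)
    also have "\<dots> = r z * M"
      by (simp add: r_def cn_norm_power2 M_def sum_product sum.cartesian_product)
    finally show ?thesis .
  qed
  have len: "w \<in> words n d \<Longrightarrow> length w = d" for w d by (simp add: words_def)
  define A where "A = (\<lambda>d. words n d - replicate d ` {1..n})"
  define B where "B = words n D - W"
  define C where "C = (\<lambda>(k, w). k # w) ` ({1..n} \<times> W)"
  have finABC: "finite (A d)" "finite B" "finite C" for d using fin by (auto simp: A_def B_def C_def)
  have lens: "w \<in> A d \<Longrightarrow> length w = d" "w \<in> B \<Longrightarrow> length w = D" "w \<in> C \<Longrightarrow> length w = Suc D" for w d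
    using len[OF subsetD[OF W]] by (auto simp: A_def B_def C_def dest: len)
  have disj: "A 2 \<inter> A 3 = {}" "(A 2 \<union> A 3) \<inter> B = {}" "(A 2 \<union> A 3 \<union> B) \<inter> C = {}"
    using D by (auto simp: disjoint_iff dest!: lens)
  have "word_indices n D W = A 2 \<union> A 3 \<union> B \<union> C"
    by (simp add: word_indices_def A_def B_def C_def)
  then have "(\<Sum>w\<in>word_indices n D W. m w) = sum m (A 2) + sum m (A 3) + sum m B + sum m C"
    by (simp add: sum.union_disjoint disj finABC)
  then have "(\<Sum>w\<in>word_indices n D W. m w) = (r z ^ 2 - P 2) + (r z ^ 3 - P 3) + (r z ^ D - M) + r z * M"
    using powers[of 2] powers[of 3] rest cons by (simp only: A_def B_def C_def)
  moreover have "(\<Sum>\<iota>\<in>Word ` word_indices n D W. (cmod (component \<iota> z))\<^sup>2)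
      = (\<Sum>w\<in>word_indices n D W. m w) / 3"
    by (subst sum.reindex) (auto simp: inj_on_def m_def norm_divide power_divide sum_divide_distrib)
  moreover have "(\<Sum>\<iota>\<in>Minus ` {1..n}. (cmod (component \<iota> z))\<^sup>2) = T / 6"
    by (subst sum.reindex) (auto simp: inj_on_def T_def norm_divide power_divide sum_divide_distrib)
  moreover have "(\<Sum>\<iota>\<in>(\<lambda>(i, k). Plus i k) ` ({1..n} \<times> {1..n}). (cmod (component \<iota> z))\<^sup>2) = r z * S / 6"
  proof -
    have "(\<Sum>\<iota>\<in>(\<lambda>(i, k). Plus i k) ` ({1..n} \<times> {1..n}). (cmod (component \<iota> z))\<^sup>2)
        = (\<Sum>(i, k)\<in>{1..n} \<times> {1..n}. (cmod (z i ^ 2 + z i ^ 3))\<^sup>2 * (cmod (z k))\<^sup>2 / 6)"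
      by (subst sum.reindex)
        (auto simp: inj_on_def norm_divide norm_mult power_divide power_mult_distrib intro!: sum.cong)
    also have "\<dots> = S * r z / 6"
      by (simp add: S_def r_def cn_norm_power2 sum_product sum.cartesian_product sum_divide_distrib
          case_prod_unfold)
    finally show ?thesis by (simp add: mult.commute)
  qed
  moreover have "(\<Sum>\<iota>\<in>indices n D W. (cmod (component \<iota> z))\<^sup>2)
      = (\<Sum>\<iota>\<in>Word ` word_indices n D W. (cmod (component \<iota> z))\<^sup>2)
        + (\<Sum>\<iota>\<in>Minus ` {1..n}. (cmod (component \<iota> z))\<^sup>2)
        + (\<Sum>\<iota>\<in>(\<lambda>(i, k). Plus i k) ` ({1..n} \<times> {1..n}). (cmod (component \<iota> z))\<^sup>2)"
  proof -
    have f: "finite (word_indices n D W)" using fin by (auto simp: word_indices_def)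
    show ?thesis unfolding indices_def
      by (subst sum.union_disjoint; use f in auto)+
  qed
  ultimately have "(\<Sum>\<iota>\<in>indices n D W. (cmod (component \<iota> z))\<^sup>2)
      = ((r z ^ 2 - P 2) + (r z ^ 3 - P 3) + (r z ^ D - M) + r z * M) / 3 + T / 6 + r z * S / 6"
    by (simp only:)
  also have "T = 2 * P 2 + 2 * P 3 - S" using ST by simp
  also have "((r z ^ 2 - P 2) + (r z ^ 3 - P 3) + (r z ^ D - M) + r z * M) / 3
        + (2 * P 2 + 2 * P 3 - S) / 6 + r z * S / 6
      = (r z ^ 2 + r z ^ 3 + r z ^ D) / 3 - (1 - r z) * (S / 6 + M / 3)"
    by (simp add: field_simps)
  finally show ?thesis by (simp add: defect_def S_def M_def m_def)
qed

section \<open>Words separating a permutation group\<close>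

text \<open>The multiplicities of the letters increase, so the word is determined, among its images under
  permutations of the letters, by its sum (\<open>rearrangement_base_word\<close>). The offset \<open>3\<close> makes it
  long enough for \<open>sum_component\<close>.\<close>

definition base_word :: "nat \<Rightarrow> nat list" where
  "base_word n = concat (map (\<lambda>i. replicate (i + 3) i) [1..<Suc n])"

lemma set_base_word: "set (base_word n) = {1..n}"
  by (auto simp: base_word_def)

lemma length_base_word: "n \<ge> 1 \<Longrightarrow> length (base_word n) \<ge> 4"
  by (induction n rule: dec_induct) (auto simp: base_word_def)

lemma sum_list_map_base_word: "sum_list (map g (base_word n)) = (\<Sum>i=1..n. (i + 3) * g i)"
  for g :: "nat \<Rightarrow> nat"
  by (induction n) (auto simp: base_word_def sum_list_replicate map_replicate_const)

text \<open>The case of equality in the rearrangement inequality, from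
  \<open>\<Sum> (i - g i)\<^sup>2 = 2 * (\<Sum> i\<^sup>2 - \<Sum> i * g i)\<close>.\<close>

lemma rearrangement_base_word:
  assumes g: "g permutes {1..n}"
  defines "X \<equiv> sum_list (map g (base_word n))" and "Y \<equiv> sum_list (base_word n)"
  shows "X \<le> Y" and "X = Y \<Longrightarrow> g = id"
proof -
  have sq: "(\<Sum>i=1..n. (int (g i))\<^sup>2) = (\<Sum>i=1..n. (int i)\<^sup>2)"
    using sum.permute[OF g, of "\<lambda>i. (int i)\<^sup>2"] by (simp add: comp_def)
  have lin: "(\<Sum>i=1..n. int (g i)) = (\<Sum>i=1..n. int i)"
    using sum.permute[OF g, of int] by (simp add: comp_def)
  have "(\<Sum>i=1..n. (int i - int (g i))\<^sup>2)
      = 2 * ((\<Sum>i=1..n. (int i)\<^sup>2) - (\<Sum>i=1..n. int i * int (g i)))"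
    using sq by (simp add: power2_diff sum.distrib sum_subtractf sum_distrib_left mult.assoc)
  also have "\<dots> = 2 * (int (sum_list (map id (base_word n))) - int (sum_list (map g (base_word n))))"
    using lin unfolding sum_list_map_base_word
    by (simp add: distrib_right sum.distrib power2_eq_square flip: sum_distrib_left)
  finally have eq: "(\<Sum>i=1..n. (int i - int (g i))\<^sup>2) = 2 * (int Y - int X)"
    by (simp add: X_def Y_def)
  have "(\<Sum>i=1..n. (int i - int (g i))\<^sup>2) \<ge> 0" by (rule sum_nonneg) simp
  then show "X \<le> Y" unfolding eq by simp
  assume "X = Y"
  then have "(\<Sum>i=1..n. (int i - int (g i))\<^sup>2) = 0" using eq by simp
  then have "g i = i" if "i \<in> {1..n}" for i using that by (simp add: sum_nonneg_eq_0_iff)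
  moreover have "g i = i" if "i \<notin> {1..n}" for i using g that by (simp add: permutes_def)
  ultimately show "g = id" by (auto simp: fun_eq_iff)
qed

lemma sym_subgroupD:
  assumes G: "subgroup G (sym_group n)"
  shows "g \<in> G \<Longrightarrow> g permutes {1..n}" "id \<in> G" "g \<in> G \<Longrightarrow> h \<in> G \<Longrightarrow> g \<circ> h \<in> G"
    "g \<in> G \<Longrightarrow> inv' g \<in> G"
proof -
  show g: "g permutes {1..n}" if "g \<in> G" for g
    using subgroup.subset[OF G] that by (auto simp: sym_group_def)
  show "id \<in> G" using subgroup.one_closed[OF G] by (simp add: sym_group_one)
  show "g \<circ> h \<in> G" if "g \<in> G" "h \<in> G"
    using subgroup.m_closed[OF G that] by (simp add: sym_group_mult)
  show "inv' g \<in> G" if "g \<in> G"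
    using subgroup.m_inv_closed[OF G that] g[OF that] by (simp add: sym_group_carrier)
qed

text \<open>The last assumption says that the sum of the squared moduli of the monomials in \<open>W\<close> distinguishes the
  elements of \<open>G\<close> from all other permutations of the coordinates.\<close>

locale separating_words =
  fixes n :: nat and G :: "(nat \<Rightarrow> nat) set" and D :: nat and W :: "nat list set"
  assumes G: "subgroup G (sym_group n)"
    and D: "4 \<le> D"
    and W: "W \<subseteq> words n D"
    and W_inv: "g \<in> G \<Longrightarrow> w \<in> W \<Longrightarrow> map g w \<in> W"
    and W_sep: "\<sigma> permutes {1..n} \<Longrightarrow>
      (\<And>z. z \<in> cn_ball n \<Longrightarrow>
        (\<Sum>w\<in>W. (cmod (wmon z (map (inv' \<sigma>) w)))\<^sup>2) = (\<Sum>w\<in>W. (cmod (wmon z w))\<^sup>2)) \<Longrightarrow> \<sigma> \<in> G"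

text \<open>Take the \<open>G\<close>-orbit of the base word. At a point with \<open>\<bar>z\<^sub>i\<bar>\<^sup>2\<close> proportional to \<open>s ^ i\<close> the squared modulus of
  the monomial of a word \<open>w\<close> is proportional to \<open>s ^ sum_list w\<close>. For large \<open>s\<close> the base word dominates,
  and it can only be matched by a permuted orbit containing a word of the same sum, that is, the base
  word itself. For \<open>n = 0\<close> there are no letters and nothing to separate.\<close>

lemma separating_words_exist:
  assumes G: "subgroup G (sym_group n)"
  shows "\<exists>D W. separating_words n G D W"
proof (cases "n = 0")
  case True
  have "separating_words n G 4 {}"
    by (rule separating_words.intro) (use G sym_subgroupD(2)[OF G] True in auto)
  then show ?thesis by blast
next
  case False
  note Gs = sym_subgroupD[OF G]
  define D where "D = length (base_word n)"
  define W where "W = (\<lambda>g. map g (base_word n)) ` G"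
  have "map g (base_word n) \<in> words n D" if "g \<in> G" for g
    using permutes_image[OF Gs(1)[OF that]] by (simp add: words_def D_def set_base_word)
  then have W: "W \<subseteq> words n D" by (auto simp: W_def)
  have finW: "finite W" by (rule finite_subset[OF W finite_words])
  have base: "base_word n \<in> W" using Gs(2) by (force simp: W_def)
  have "separating_words n G D W"
  proof (rule separating_words.intro)
    show "subgroup G (sym_group n)" by (rule G)
    show "4 \<le> D" using length_base_word[of n] False by (simp add: D_def)
    show "W \<subseteq> words n D" by (rule W)
    show "map g w \<in> W" if gw: "g \<in> G" "w \<in> W" for g w
    proof -
      obtain k where k: "k \<in> G" "w = map k (base_word n)" using gw(2) by (auto simp: W_def)
      then have "map g w = map (g \<circ> k) (base_word n)" by simp
      then show ?thesis using Gs(3)[OF gw(1) k(1)] unfolding W_def by blast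
    qed
    fix \<sigma> assume \<sigma>: "\<sigma> permutes {1..n}"
      and eq: "\<And>z. z \<in> cn_ball n \<Longrightarrow>
        (\<Sum>w\<in>W. (cmod (wmon z (map (inv' \<sigma>) w)))\<^sup>2) = (\<Sum>w\<in>W. (cmod (wmon z w))\<^sup>2)"
    \<comment> \<open>\<open>s\<close> exceeds the number of words, so a single word of maximal sum outweighs any number of
      words of smaller sum; \<open>c\<close> scales the point into the ball.\<close>
    define s where "s = card W + 1"
    define c where "c = 1 / (1 + (\<Sum>i=1..n. real s ^ i))"
    have pos: "1 + (\<Sum>i=1..n. real s ^ i) > 0" by (intro add_pos_nonneg sum_nonneg) auto
    have c: "c > 0" using pos by (simp add: c_def)
    define z where "z = (\<lambda>i. if i \<in> {1..n} then complex_of_real (sqrt (c * real s ^ i)) else 0)"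
    have zi: "(cmod (z i))\<^sup>2 = c * real s ^ i" if "i \<in> {1..n}" for i
      using that c by (simp add: z_def)
    have "(cn_norm n z)\<^sup>2 = c * (\<Sum>i=1..n. real s ^ i)"
      unfolding cn_norm_power2 sum_distrib_left by (rule sum.cong) (auto simp: zi)
    also have "\<dots> < 1" using pos by (simp add: c_def)
    finally have z: "z \<in> cn_ball n"
      by (auto simp: cn_ball_def cn_space_def z_def cn_norm_less_1_iff)
    have val: "(cmod (wmon z w))\<^sup>2 = c ^ length w * real (s ^ sum_list w)" if "set w \<subseteq> {1..n}" for w
      using that by (induction w) (auto simp: norm_mult power_mult_distrib zi power_add)
    have \<sigma>': "inv' \<sigma> permutes {1..n}" by (rule permutes_inv[OF \<sigma>])
    have WD: "set w \<subseteq> {1..n}" "length w = D" "set (map (inv' \<sigma>) w) \<subseteq> {1..n}" if "w \<in> W" for w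
    proof -
      have "w \<in> words n D" using W that by blast
      then show *: "set w \<subseteq> {1..n}" "length w = D" by (auto simp: words_def)
      show "set (map (inv' \<sigma>) w) \<subseteq> {1..n}"
        using image_mono[OF *(1), of "inv' \<sigma>"] by (simp only: set_map permutes_image[OF \<sigma>'])
    qed
    have "c ^ D * real (\<Sum>w\<in>W. s ^ sum_list (map (inv' \<sigma>) w)) = c ^ D * real (\<Sum>w\<in>W. s ^ sum_list w)"
    proof -
      have "(\<Sum>w\<in>W. (cmod (wmon z (map (inv' \<sigma>) w)))\<^sup>2)
          = (\<Sum>w\<in>W. c ^ D * real (s ^ sum_list (map (inv' \<sigma>) w)))"
        by (rule sum.cong[OF refl], subst val[OF WD(3)]) (simp_all add: WD(2))
      moreover have "(\<Sum>w\<in>W. (cmod (wmon z w))\<^sup>2) = (\<Sum>w\<in>W. c ^ D * real (s ^ sum_list w))"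
        by (rule sum.cong[OF refl], subst val[OF WD(1)]) (simp_all add: WD(2))
      ultimately show ?thesis using eq[OF z] by (simp only: sum_distrib_left of_nat_sum)
    qed
    then have eq': "(\<Sum>w\<in>W. s ^ sum_list (map (inv' \<sigma>) w)) = (\<Sum>w\<in>W. s ^ sum_list w)"
      using c by (simp only: mult_cancel_left of_nat_eq_iff power_eq_0_iff) simp
    define M where "M = sum_list (base_word n)"
    show "\<sigma> \<in> G"
    proof (rule ccontr)
      assume notin: "\<sigma> \<notin> G"
      have lt: "sum_list (map (inv' \<sigma>) w) < M" if wW: "w \<in> W" for w
      proof -
        obtain g where g: "g \<in> G" "w = map g (base_word n)" using wW by (auto simp: W_def)
        have perm: "(inv' \<sigma> \<circ> g) permutes {1..n}" by (rule permutes_compose[OF Gs(1)[OF g(1)] \<sigma>'])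
        have "inv' \<sigma> \<circ> g \<noteq> id"
        proof
          assume "inv' \<sigma> \<circ> g = id"
          then have "\<sigma> \<circ> (inv' \<sigma> \<circ> g) = \<sigma>" by simp
          then have "g = \<sigma>" by (simp add: comp_assoc[symmetric] permutes_inv_o[OF \<sigma>])
          then show False using g notin by simp
        qed
        then show ?thesis using rearrangement_base_word[OF perm]
          by (auto simp: g(2) M_def less_le)
      qed
      have "(\<Sum>w\<in>W. s ^ sum_list (map (inv' \<sigma>) w)) \<le> (\<Sum>w\<in>W. s ^ (M - 1))"
        using lt by (intro sum_mono power_increasing) (auto simp: s_def dest!: less_imp_Suc_add[OF lt])
      also have "\<dots> < s * s ^ (M - 1)" by (simp add: s_def)
      also have "\<dots> = s ^ M" using lt[OF base] by (cases M) auto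
      also have "\<dots> \<le> (\<Sum>w\<in>W. s ^ sum_list w)"
        unfolding M_def by (rule member_le_sum[OF base]) (auto simp: finW)
      finally show False using eq' by simp
    qed
  qed
  then show ?thesis by blast
qed

section \<open>Permutations of the coordinates as automorphisms\<close>

lemma sum_permute_inv:
  assumes "\<sigma> permutes {1..n}"
  shows "(\<Sum>i=1..n. p (inv' \<sigma> i)) = (\<Sum>i=1..n. p i)"
  using sum.permute[OF permutes_inv[OF assms], of p] by (simp add: comp_def)

lemma permuted_in_cn_space:
  assumes "\<sigma> permutes {1..n}" "z \<in> cn_space n"
  shows "(\<lambda>i. z (inv' \<sigma> i)) \<in> cn_space n"
  using assms permutes_not_in[OF permutes_inv[OF assms(1)]] by (auto simp: cn_space_def)

lemma cn_norm_permuted: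
  assumes "\<sigma> permutes {1..n}" shows "cn_norm n (\<lambda>i. z (inv' \<sigma> i)) = cn_norm n z"
proof -
  have "(cn_norm n (\<lambda>i. z (inv' \<sigma> i)))\<^sup>2 = (cn_norm n z)\<^sup>2"
    unfolding cn_norm_power2 by (rule sum_permute_inv[OF assms])
  then show ?thesis by simp
qed

lemma permuted_in_cn_ball:
  "\<sigma> permutes {1..n} \<Longrightarrow> z \<in> cn_ball n \<Longrightarrow> (\<lambda>i. z (inv' \<sigma> i)) \<in> cn_ball n"
  by (simp add: cn_ball_def permuted_in_cn_space cn_norm_permuted)

lemma holomorphic_perm_unitary:
  assumes "\<sigma> permutes {1..n}" shows "holomorphic_ball_map n n (perm_unitary n \<sigma>)"
proof -
  have "holomorphic_ball_map n n (\<lambda>z i. z (inv' \<sigma> i))"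
    by (intro taylor_remainder_imp_holomorphic taylor_remainder_coordinate)
      (use permutes_in_image[OF permutes_inv[OF assms]] in blast)
  also have "?this \<longleftrightarrow> ?thesis"
    by (rule holomorphic_ball_map_cong) (simp add: perm_unitary_def)
  finally show ?thesis .
qed

lemma perm_unitary_in_Aut_ball:
  assumes \<sigma>: "\<sigma> permutes {1..n}" shows "perm_unitary n \<sigma> \<in> Aut_ball n"
proof -
  have \<sigma>': "inv' \<sigma> permutes {1..n}" by (rule permutes_inv[OF \<sigma>])
  have B: "perm_unitary n \<sigma> ` cn_ball n \<subseteq> cn_ball n" if "\<sigma> permutes {1..n}" for \<sigma>
    using permuted_in_cn_ball[OF that] by (auto simp: perm_unitary_def)
  have l: "perm_unitary n (inv' \<sigma>) (perm_unitary n \<sigma> z) = z" if "z \<in> cn_ball n" for z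
    using that permuted_in_cn_ball[OF \<sigma> that]
    by (simp add: perm_unitary_def permutes_inv_inv[OF \<sigma>] permutes_inverses[OF \<sigma>])
  have r: "perm_unitary n \<sigma> (perm_unitary n (inv' \<sigma>) z) = z" if "z \<in> cn_ball n" for z
    using that permuted_in_cn_ball[OF \<sigma>' that]
    by (simp add: perm_unitary_def permutes_inv_inv[OF \<sigma>] permutes_inverses[OF \<sigma>])
  have bij: "bij_betw (perm_unitary n \<sigma>) (cn_ball n) (cn_ball n)"
    by (rule bij_betw_byWitness[of _ "perm_unitary n (inv' \<sigma>)"]) (use l r B \<sigma> \<sigma>' in auto)
  have "inv_into (cn_ball n) (perm_unitary n \<sigma>) z = perm_unitary n (inv' \<sigma>) z" if "z \<in> cn_ball n" for z
    by (rule inv_into_f_eq) (use bij r[OF that] B[OF \<sigma>'] that in \<open>auto simp: bij_betw_def\<close>)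
  then have "holomorphic_ball_map n n (inv_into (cn_ball n) (perm_unitary n \<sigma>))"
    using holomorphic_perm_unitary[OF \<sigma>'] holomorphic_ball_map_cong by metis
  then show ?thesis
    using bij holomorphic_perm_unitary[OF \<sigma>] by (simp add: Aut_ball_def Bij_def perm_unitary_def)
qed

section \<open>Unitary maps preserving the defect\<close>

text \<open>Passing to the part odd under \<open>z \<mapsto> - z\<close> discards the monomials in \<open>W\<close> and keeps the mixed terms of
  \<open>z\<^sub>i\<^sup>2 + z\<^sub>i\<^sup>3\<close>, which are sensitive to the phases of the coordinates.\<close>

lemma defect_odd_part:
  "defect n W z - defect n W (\<lambda>i. - z i) = 2 / 3 * (\<Sum>i=1..n. cmod (z i) ^ 4 * Re (z i))"
proof -
  have "(cmod (a ^ 2 + a ^ 3))\<^sup>2 - (cmod ((- a) ^ 2 + (- a) ^ 3))\<^sup>2 = 4 * (cmod a ^ 4 * Re a)"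
    for a :: complex
  proof -
    have "(cmod (a ^ 2 + a ^ 3))\<^sup>2 - (cmod ((- a) ^ 2 + (- a) ^ 3))\<^sup>2
        = cmod a ^ 4 * ((cmod (1 + a))\<^sup>2 - (cmod (1 - a))\<^sup>2)"
    proof -
      have eqs: "a ^ 2 + a ^ 3 = a ^ 2 * (1 + a)" "(- a) ^ 2 + (- a) ^ 3 = a ^ 2 * (1 - a)"
        by (simp_all add: power2_eq_square power3_eq_cube algebra_simps)
      show ?thesis unfolding eqs
        by (simp only: norm_mult norm_power power_mult_distrib flip: power_mult right_diff_distrib) simp
    qed
    also have "(cmod (1 + a))\<^sup>2 - (cmod (1 - a))\<^sup>2 = 4 * Re a"
      unfolding cmod_power2 by (simp add: power2_eq_square algebra_simps)
    finally show ?thesis by simp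
  qed
  then have "(\<Sum>i=1..n. (cmod (z i ^ 2 + z i ^ 3))\<^sup>2) - (\<Sum>i=1..n. (cmod ((- z i) ^ 2 + (- z i) ^ 3))\<^sup>2)
      = 4 * (\<Sum>i=1..n. cmod (z i) ^ 4 * Re (z i))"
    by (simp only: sum_subtractf[symmetric] sum_distrib_left)
  then show ?thesis unfolding defect_def cmod_wmon_uminus by simp
qed

text \<open>Each term of the second sum is at most the corresponding term of the first, with equality only if
  \<open>u j\<close> is \<open>0\<close> or \<open>1\<close>.\<close>

lemma unit_vector_is_basis_vector:
  fixes u :: "nat \<Rightarrow> complex"
  assumes unit: "(\<Sum>j=1..n. (cmod (u j))\<^sup>2) = 1" and quintic: "(\<Sum>j=1..n. cmod (u j) ^ 4 * Re (u j)) = 1"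
  obtains k where "k \<in> {1..n}" "\<And>j. j \<in> {1..n} \<Longrightarrow> u j = (if j = k then 1 else 0)"
proof -
  have le1: "cmod (u j) \<le> 1" if "j \<in> {1..n}" for j
  proof -
    have "(cmod (u j))\<^sup>2 \<le> (\<Sum>j=1..n. (cmod (u j))\<^sup>2)" by (rule member_le_sum) (use that in auto)
    then show ?thesis using unit by (simp add: abs_square_le_1)
  qed
  have sq: "cmod (u j) ^ 4 * Re (u j) = (cmod (u j))\<^sup>2 * ((cmod (u j))\<^sup>2 * Re (u j))" for j
    by (simp add: power4_eq_xxxx power2_eq_square)
  have bound: "(cmod (u j))\<^sup>2 * Re (u j) \<le> 1" if "j \<in> {1..n}" for j
  proof -
    have "(cmod (u j))\<^sup>2 * Re (u j) \<le> (cmod (u j))\<^sup>2 * cmod (u j)"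
      by (intro mult_left_mono complex_Re_le_cmod) simp
    also have "\<dots> \<le> 1 * 1" by (intro mult_mono le1 that) (use le1[OF that] in \<open>auto simp: abs_square_le_1\<close>)
    finally show ?thesis by simp
  qed
  have "(\<Sum>j=1..n. (cmod (u j))\<^sup>2 * (1 - (cmod (u j))\<^sup>2 * Re (u j))) = 0"
    using unit quintic by (simp add: right_diff_distrib sum_subtractf flip: sq)
  moreover have "(cmod (u j))\<^sup>2 * (1 - (cmod (u j))\<^sup>2 * Re (u j)) \<ge> 0" if "j \<in> {1..n}" for j
    using bound[OF that] by simp
  ultimately have "\<forall>j\<in>{1..n}. (cmod (u j))\<^sup>2 * (1 - (cmod (u j))\<^sup>2 * Re (u j)) = 0"
    by (subst (asm) sum_nonneg_eq_0_iff) auto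
  moreover have "u j = 1" if j: "j \<in> {1..n}" and eq: "1 - (cmod (u j))\<^sup>2 * Re (u j) = 0" for j
  proof -
    have r: "Re (u j) > 0"
      using eq by (smt (verit) mult_nonneg_nonpos zero_le_power2)
    have "(cmod (u j))\<^sup>2 * Re (u j) \<le> 1 * Re (u j)"
      by (rule mult_right_mono) (use le1[OF j] r in \<open>auto simp: abs_square_le_1\<close>)
    then have "Re (u j) \<ge> 1" using eq by simp
    then have "Re (u j) = 1" using le1[OF j] complex_Re_le_cmod[of "u j"] by linarith
    moreover have "(Re (u j))\<^sup>2 + (Im (u j))\<^sup>2 \<le> 1"
      using le1[OF j] by (simp add: abs_square_le_1 flip: cmod_power2)
    ultimately show ?thesis by (simp add: complex_eq_iff)
  qed
  ultimately have val: "u j = 0 \<or> u j = 1" if "j \<in> {1..n}" for j using that by fastforce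
  have "\<exists>k\<in>{1..n}. u k \<noteq> 0"
  proof (rule ccontr)
    assume "\<not> (\<exists>k\<in>{1..n}. u k \<noteq> 0)"
    then have "(\<Sum>j=1..n. (cmod (u j))\<^sup>2) = 0" by (intro sum.neutral) auto
    then show False using unit by simp
  qed
  then obtain k where k: "k \<in> {1..n}" "u k = 1" using val by blast
  have "(\<Sum>j=1..n. (cmod (u j))\<^sup>2) = (cmod (u k))\<^sup>2 + (\<Sum>j\<in>{1..n} - {k}. (cmod (u j))\<^sup>2)"
    by (rule sum.remove) (use k in auto)
  then have "(\<Sum>j\<in>{1..n} - {k}. (cmod (u j))\<^sup>2) = 0" using unit k(2) by simp
  then have "\<forall>j\<in>{1..n} - {k}. (cmod (u j))\<^sup>2 = 0" by (subst (asm) sum_nonneg_eq_0_iff) auto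
  then show ?thesis using that[OF k(1)] k(2) by auto
qed

text \<open>The columns of the matrix of \<open>\<gamma>\<close> are unit vectors at which the odd part of the defect has the same
  value as at a basis vector. The evaluation takes place at half a basis vector, which lies in the ball.\<close>

lemma defect_preserving_Aut_is_permutation:
  assumes \<gamma>: "\<gamma> \<in> Aut_ball n" and \<gamma>0: "\<gamma> (\<lambda>i. 0) = (\<lambda>i. 0)"
    and inv: "\<And>z. z \<in> cn_ball n \<Longrightarrow> defect n W (\<gamma> z) = defect n W z"
  obtains \<sigma> where "\<sigma> permutes {1..n}" "\<gamma> = perm_unitary n \<sigma>"
proof -
  note A = Aut_ballD[OF \<gamma>] and norm = Aut_ball_norm[OF \<gamma> \<gamma>0]
  obtain A where A_lin: "\<And>z j. z \<in> cn_ball n \<Longrightarrow> j \<in> {1..n} \<Longrightarrow> \<gamma> z j = (\<Sum>i=1..n. A j i * z i)"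
    by (rule Aut_ball_linear[OF \<gamma> \<gamma>0]) (rule that)
  have \<gamma>B: "\<gamma> z \<in> cn_ball n" if "z \<in> cn_ball n" for z using A(2) that by auto
  have col: "\<exists>k\<in>{1..n}. \<forall>j\<in>{1..n}. A j i = (if j = k then 1 else 0)" if i: "i \<in> {1..n}" for i
  proof -
    define e where "e = (\<lambda>s l. if l = i then s / 2 else (0::complex))"
    have e: "e s \<in> cn_ball n" and ne: "(cn_norm n (e s))\<^sup>2 = 1 / 4" if "s = 1 \<or> s = -1" for s
    proof -
      have "(cn_norm n (e s))\<^sup>2 = (\<Sum>l=1..n. if l = i then 1 / 4 else 0)"
        unfolding cn_norm_power2 by (rule sum.cong) (use that in \<open>auto simp: e_def power2_eq_square\<close>)
      also have "\<dots> = 1 / 4" using i by simp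
      finally show "(cn_norm n (e s))\<^sup>2 = 1 / 4" .
      then show "e s \<in> cn_ball n"
        using i by (auto simp: cn_ball_def cn_norm_less_1_iff cn_space_def e_def)
    qed
    have \<gamma>e: "\<gamma> (e s) j = s * A j i / 2" if "s = 1 \<or> s = -1" "j \<in> {1..n}" for s j
    proof -
      have "(\<Sum>l=1..n. A j l * e s l) = (\<Sum>l=1..n. if l = i then s * A j i / 2 else 0)"
        by (rule sum.cong) (auto simp: e_def)
      then show ?thesis using A_lin[OF e[OF that(1)] that(2)] i by simp
    qed
    have "(\<Sum>j=1..n. (cmod (A j i))\<^sup>2) = 4 * (cn_norm n (\<gamma> (e 1)))\<^sup>2"
      unfolding cn_norm_power2 sum_distrib_left
      by (rule sum.cong) (auto simp: \<gamma>e norm_divide power_divide)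
    also have "\<dots> = 1" using norm[OF e[of 1]] ne[of 1] by simp
    finally have unit: "(\<Sum>j=1..n. (cmod (A j i))\<^sup>2) = 1" .
    have "\<gamma> (e (-1)) = (\<lambda>j. - \<gamma> (e 1) j)"
      by (rule cn_space_eqI[OF cn_ball_space[OF \<gamma>B[OF e]]])
        (use cn_ball_space[OF \<gamma>B[OF e[of 1]]] in \<open>auto simp: cn_space_def \<gamma>e\<close>)
    moreover have "e (-1) = (\<lambda>l. - e 1 l)" by (auto simp: e_def)
    ultimately have "(\<Sum>j=1..n. cmod (\<gamma> (e 1) j) ^ 4 * Re (\<gamma> (e 1) j))
        = (\<Sum>j=1..n. cmod (e 1 j) ^ 4 * Re (e 1 j))"
      using defect_odd_part[of n W "\<gamma> (e 1)"] defect_odd_part[of n W "e 1"]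
        inv[OF e[of 1]] inv[OF e[of "-1"]] by simp
    moreover have "(\<Sum>j=1..n. cmod (\<gamma> (e 1) j) ^ 4 * Re (\<gamma> (e 1) j))
        = (\<Sum>j=1..n. cmod (A j i) ^ 4 * Re (A j i)) / 32"
      unfolding sum_divide_distrib
      by (rule sum.cong) (auto simp: \<gamma>e norm_divide power_divide)
    moreover have "(\<Sum>j=1..n. cmod (e 1 j) ^ 4 * Re (e 1 j)) = (\<Sum>j=1..n. if j = i then 1 / 32 else 0)"
      by (rule sum.cong) (auto simp: e_def norm_divide power_divide)
    ultimately have "(\<Sum>j=1..n. cmod (A j i) ^ 4 * Re (A j i)) = 1" using i by simp
    from unit_vector_is_basis_vector[OF unit this] show ?thesis by metis
  qed
  have "\<forall>i\<in>{1..n}. \<exists>k. k \<in> {1..n} \<and> (\<forall>j\<in>{1..n}. A j i = (if j = k then 1 else 0))"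
    using col by blast
  from bchoice[OF this] obtain p
    where p: "\<And>i. i \<in> {1..n} \<Longrightarrow> p i \<in> {1..n}"
      "\<And>i j. i \<in> {1..n} \<Longrightarrow> j \<in> {1..n} \<Longrightarrow> A j i = (if j = p i then 1 else 0)" by blast
  have inj: "inj_on p {1..n}"
  proof (rule inj_onI, rule ccontr)
    fix i k assume ik: "i \<in> {1..n}" "k \<in> {1..n}" "p i = p k" "i \<noteq> k"
    define z where "z = (\<lambda>l. (if l = i then 1 / 4 else 0) - (if l = k then 1 / 4 else (0::complex)))"
    have "cn_norm n z \<le> (\<Sum>l=1..n. cmod (z l))" by (rule cn_norm_le_sum)
    also have "\<dots> \<le> (\<Sum>l=1..n. (if l = i then 1 / 4 else 0) + (if l = k then 1 / 4 else 0))"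
      by (rule sum_mono) (auto simp: z_def norm_divide)
    also have "\<dots> < 1" using ik by (simp add: sum.distrib)
    finally have z: "z \<in> cn_ball n" using ik by (auto simp: cn_ball_def cn_space_def z_def)
    have "\<gamma> z j = 0" if "j \<in> {1..n}" for j
    proof -
      have "(\<Sum>l=1..n. A j l * z l)
          = (\<Sum>l=1..n. (if l = i then A j i / 4 else 0) - (if l = k then A j k / 4 else 0))"
        by (rule sum.cong) (auto simp: z_def)
      also have "\<dots> = 0" using ik that p(2) by (simp add: sum_subtractf)
      finally show ?thesis using A_lin[OF z that] by simp
    qed
    then have "(cn_norm n (\<gamma> z))\<^sup>2 = 0" unfolding cn_norm_power2 by simp
    then have "cn_norm n z = 0" using norm[OF z] by simp
    then have "z i = 0" using cn_norm_eq_0_imp ik(1) by blast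
    then show False using ik(4) by (simp add: z_def)
  qed
  define \<sigma> where "\<sigma> = (\<lambda>i. if i \<in> {1..n} then p i else i)"
  have "p ` {1..n} = {1..n}" by (rule endo_inj_surj[OF _ _ inj]) (use p(1) in auto)
  then have "bij_betw p {1..n} {1..n}" using inj by (simp add: bij_betw_def)
  then have "bij_betw \<sigma> {1..n} {1..n}"
    by (subst bij_betw_cong[of _ _ p]) (auto simp: \<sigma>_def)
  then have \<sigma>: "\<sigma> permutes {1..n}" by (rule bij_imp_permutes) (auto simp: \<sigma>_def)
  have "\<gamma> z = (\<lambda>j. z (inv' \<sigma> j))" if z: "z \<in> cn_ball n" for z
  proof (rule cn_space_eqI[OF cn_ball_space[OF \<gamma>B[OF z]] permuted_in_cn_space[OF \<sigma> cn_ball_space[OF z]]])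
    fix j assume j: "j \<in> {1..n}"
    have k: "inv' \<sigma> j \<in> {1..n}" using permutes_in_image[OF permutes_inv[OF \<sigma>]] j by blast
    have "\<gamma> z j = (\<Sum>i=1..n. if i = inv' \<sigma> j then z i else 0)"
      unfolding A_lin[OF z j]
    proof (rule sum.cong[OF refl])
      fix i assume i: "i \<in> {1..n}"
      have "i = inv' \<sigma> j \<longleftrightarrow> j = p i"
        using permutes_inv_eq[OF \<sigma>, of j i] i by (auto simp: \<sigma>_def)
      then show "A j i * z i = (if i = inv' \<sigma> j then z i else 0)" using p(2)[OF i j] by simp
    qed
    then show "\<gamma> z j = z (inv' \<sigma> j)" using k by simp
  qed
  then have "\<gamma> = perm_unitary n \<sigma>"
    using A(6) by (intro extensionalityI[of _ "cn_ball n"]) (auto simp: perm_unitary_def)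
  then show ?thesis using that \<sigma> by blast
qed

section \<open>The Hermitian invariant group\<close>

definition component_map :: "nat \<Rightarrow> (nat \<Rightarrow> idx) \<Rightarrow> (nat \<Rightarrow> complex) \<Rightarrow> nat \<Rightarrow> complex" where
  "component_map N b z = (\<lambda>j. if j \<in> {1..N} then component (b j) z else 0)"

context separating_words
begin

text \<open>All pieces of the index set are unions of orbits under relabelling by \<open>G\<close>, so \<open>G\<close> permutes the
  components of the map.\<close>

lemma relabel_indices:
  assumes h: "h \<in> G" and \<iota>: "\<iota> \<in> indices n D W"
  shows "relabel h \<iota> \<in> indices n D W"
proof -
  note Gs = sym_subgroupD[OF G]
  have im: "h i \<in> {1..n}" if "i \<in> {1..n}" for i
    using permutes_in_image[OF Gs(1)[OF h]] that by blast
  have im': "inv' h i \<in> {1..n}" if "i \<in> {1..n}" for i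
    using permutes_in_image[OF Gs(1)[OF Gs(4)[OF h]]] that by blast
  have unmap: "map (inv' h) (map h w) = w" for w
    by (simp add: comp_def permutes_inverses[OF Gs(1)[OF h]])
  have w: "map h w \<in> words n d" if "w \<in> words n d" for w d
    using that im by (auto simp: words_def)
  have r: "map h w \<notin> replicate d ` {1..n}" if "w \<notin> replicate d ` {1..n}" for w d
  proof
    assume "map h w \<in> replicate d ` {1..n}"
    then obtain i where i: "i \<in> {1..n}" "map h w = replicate d i" by blast
    then have "w = replicate d (inv' h i)" using unmap[of w] by (simp del: map_map)
    then show False using that im'[OF i(1)] by blast
  qed
  have W': "map h w \<notin> W" if "w \<notin> W" for w
    using W_inv[OF Gs(4)[OF h], of "map h w"] that unfolding unmap by blast
  have "map h w \<in> word_indices n D W" if "w \<in> word_indices n D W" for w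
    using that unfolding word_indices_def
  proof (elim UnE, goal_cases)
    case 4
    then obtain k v where "w = k # v" "k \<in> {1..n}" "v \<in> W" by auto
    then have "map h w = (\<lambda>(k, w). k # w) (h k, map h v)" "(h k, map h v) \<in> {1..n} \<times> W"
      using im[of k] W_inv[OF h] by auto
    then show ?case by blast
  qed (use w r W' in blast)+
  then show ?thesis using \<iota> im by (fastforce simp: indices_def)
qed

context
  fixes N :: nat and b :: "nat \<Rightarrow> idx"
  assumes b: "bij_betw b {1..N} (indices n D W)"
begin

lemma component_map_norm:
  "(cn_norm N (component_map N b z))\<^sup>2
     = (((cn_norm n z)\<^sup>2) ^ 2 + ((cn_norm n z)\<^sup>2) ^ 3 + ((cn_norm n z)\<^sup>2) ^ D) / 3
       - (1 - (cn_norm n z)\<^sup>2) * defect n W z"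
proof -
  have "(cn_norm N (component_map N b z))\<^sup>2 = (\<Sum>j=1..N. (cmod (component (b j) z))\<^sup>2)"
    unfolding cn_norm_power2 by (rule sum.cong) (auto simp: component_map_def)
  also have "\<dots> = (\<Sum>\<iota>\<in>indices n D W. (cmod (component \<iota> z))\<^sup>2)"
    using sum.reindex_bij_betw[OF b, of "\<lambda>\<iota>. (cmod (component \<iota> z))\<^sup>2"] .
  finally show ?thesis using sum_component[OF D W] by simp
qed

lemma component_map_space: "component_map N b z \<in> cn_space N"
  by (auto simp: component_map_def cn_space_def)

text \<open>Since \<open>r ^ 2\<close> bounds all three powers of \<open>r = \<parallel>z\<parallel>\<^sup>2\<close>, the map takes the ball into the ball and
  vanishes to second order at the origin.\<close>

lemma component_map_le:
  assumes z: "z \<in> cn_ball n" shows "cn_norm N (component_map N b z) \<le> (cn_norm n z)\<^sup>2"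
proof -
  define r where "r = (cn_norm n z)\<^sup>2"
  have r: "0 \<le> r" "r < 1" using cn_ball_norm[OF z] by (auto simp: r_def cn_norm_less_1_iff)
  have "r ^ 3 \<le> r ^ 2" "r ^ D \<le> r ^ 2" using r D by (auto intro!: power_decreasing)
  moreover have "(1 - r) * defect n W z \<ge> 0" using r defect_nonneg by simp
  moreover have diff_le: "x - y \<le> u" if "x \<le> u" "y \<ge> 0" for x y u :: real using that by simp
  ultimately have "(r ^ 2 + r ^ 3 + r ^ D) / 3 \<le> r ^ 2" "(1 - r) * defect n W z \<ge> 0" by simp_all
  then have "(cn_norm N (component_map N b z))\<^sup>2 \<le> r ^ 2"
    unfolding component_map_norm r_def[symmetric] by (rule diff_le)
  then show ?thesis unfolding r_def[symmetric] by (rule power2_le_imp_le) (rule r(1))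
qed

lemma component_map_ball: "component_map N b \<in> cn_ball n \<rightarrow> cn_ball N"
proof
  fix z assume z: "z \<in> cn_ball n"
  have "cn_norm N (component_map N b z) < 1"
    using component_map_le[OF z] cn_ball_norm[OF z] unfolding cn_norm_less_1_iff[of n z] by linarith
  then show "component_map N b z \<in> cn_ball N" using component_map_space by (simp add: cn_ball_def)
qed

lemma component_map_polynomial: "polynomial_ball_map n N (component_map N b)"
  unfolding polynomial_ball_map_def
proof
  fix j assume j: "j \<in> {1..N}"
  then have "polynomial_function n (component (b j))"
    using b by (intro polynomial_function_component[OF W]) (auto simp: bij_betw_def)
  then show "\<exists>(A :: (nat \<Rightarrow> nat) set) c. finite A \<and>
      (\<forall>z\<in>cn_ball n. component_map N b z j = (\<Sum>\<alpha>\<in>A. c \<alpha> * (\<Prod>i=1..n. z i ^ \<alpha> i)))"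
    using j unfolding polynomial_function_def component_map_def by auto
qed

lemma component_map_proper: "proper_holomorphic_ball_map n N (component_map N b)"
proof (rule proper_if_sphere_to_sphere[OF component_map_ball
      polynomial_ball_map_holomorphic[OF component_map_polynomial]])
  show "continuous_on UNIV (component_map N b)"
    unfolding component_map_def
  proof (rule continuous_on_coordinatewise_then_product)
    show "continuous_on UNIV (\<lambda>z. if j \<in> {1..N} then component (b j) z else 0)" for j
      by (cases "j \<in> {1..N}") (simp_all only: if_True if_False continuous_on_component continuous_on_const)
  qed
  fix z assume "cn_norm n z = 1"
  then have "(cn_norm N (component_map N b z))\<^sup>2 = 1" by (simp add: component_map_norm)
  then show "cn_norm N (component_map N b z) = 1" by (simp add: power2_eq_1_iff) (smt (verit) cn_norm_nonneg)
qed

lemma perm_unitary_in_hermitian_invariant_group: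
  assumes g: "g \<in> G"
  shows "perm_unitary n g \<in> hermitian_invariant_group n N (component_map N b)"
proof -
  note Gs = sym_subgroupD[OF G]
  let ?h = "inv' g"
  have h: "?h \<in> G" and gp: "g permutes {1..n}" by (rule Gs(4)[OF g], rule Gs(1)[OF g])
  \<comment> \<open>the permutation of \<open>{1..N}\<close> corresponding to relabelling by the inverse of \<open>g\<close>\<close>
  define \<kappa> where "\<kappa> = (\<lambda>j. if j \<in> {1..N} then inv_into {1..N} b (relabel ?h (b j)) else j)"
  have bI: "b j \<in> indices n D W" if "j \<in> {1..N}" for j using b that by (auto simp: bij_betw_def)
  have im: "b ` {1..N} = indices n D W" and injb: "inj_on b {1..N}" using b by (auto simp: bij_betw_def)
  have rel: "relabel ?h (b j) \<in> b ` {1..N}" if "j \<in> {1..N}" for j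
    unfolding im by (rule relabel_indices[OF h bI[OF that]])
  have b\<kappa>: "b (\<kappa> j) = relabel ?h (b j)" and \<kappa>N: "\<kappa> j \<in> {1..N}" if "j \<in> {1..N}" for j
    using f_inv_into_f[OF rel[OF that]] inv_into_into[OF rel[OF that]] that by (auto simp: \<kappa>_def)
  have "inj ?h" by (rule permutes_inj[OF permutes_inv[OF gp]])
  then have inj\<kappa>: "inj_on \<kappa> {1..N}"
    using b\<kappa> injb inj_relabel by (intro inj_onI) (metis inj_eq inj_onD)
  have "\<kappa> ` {1..N} = {1..N}" by (rule endo_inj_surj[OF _ _ inj\<kappa>]) (use \<kappa>N in auto)
  then have "bij_betw \<kappa> {1..N} {1..N}" using inj\<kappa> by (simp add: bij_betw_def)
  then have \<kappa>: "\<kappa> permutes {1..N}" by (rule bij_imp_permutes) (simp only: \<kappa>_def if_False)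
  have "component_map N b (perm_unitary n g z) = perm_unitary N (inv' \<kappa>) (component_map N b z)"
    if z: "z \<in> cn_ball n" for z
  proof
    fix j
    have fz: "component_map N b z \<in> cn_ball N" using component_map_ball z by auto
    show "component_map N b (perm_unitary n g z) j = perm_unitary N (inv' \<kappa>) (component_map N b z) j"
    proof (cases "j \<in> {1..N}")
      case True
      have "component (b j) (\<lambda>i. z (?h i)) = component (b (\<kappa> j)) z"
        by (simp only: b\<kappa>[OF True] component_relabel)
      then show ?thesis
        using z fz True \<kappa>N[OF True] by (simp add: perm_unitary_def permutes_inv_inv[OF \<kappa>] component_map_def)
    next
      case False
      then have "\<kappa> j = j" by (simp only: \<kappa>_def if_False)
      moreover have "component_map N b y j = 0" for y
        using False by (simp only: component_map_def if_False)
      ultimately show ?thesis using fz by (simp add: perm_unitary_def permutes_inv_inv[OF \<kappa>])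
    qed
  qed
  then show ?thesis
    using perm_unitary_in_Aut_ball[OF gp] perm_unitary_in_Aut_ball[OF permutes_inv[OF \<kappa>]]
    unfolding hermitian_invariant_group_def by blast
qed

text \<open>The \<open>i\<close>-th partial derivatives of two components already have no common zero with \<open>c\<^sub>i \<noteq> 0\<close>: up to a
  constant they are \<open>2 c\<^sub>i - 3 c\<^sub>i\<^sup>2\<close> and \<open>3 c\<^sub>i\<^sup>2 + 4 c\<^sub>i\<^sup>3\<close>, with zeros \<open>2 / 3\<close> and \<open>- 3 / 4\<close>
  besides \<open>0\<close>.\<close>

lemma critical_point_is_origin:
  assumes c: "c \<in> cn_ball n" and K: "K \<ge> 0"
    and crit: "\<And>w. w \<in> cn_ball n \<Longrightarrow> K * cn_norm n (\<lambda>i. w i - c i) < 1 \<Longrightarrow>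
      cn_norm N (\<lambda>j. component_map N b w j - component_map N b c j)
        \<le> K * (cn_norm n (\<lambda>i. w i - c i))\<^sup>2"
  shows "c = (\<lambda>i. 0)"
proof (rule cn_space_eqI[OF cn_ball_space[OF c] cn_ball_space[OF zero_in_cn_ball]])
  fix i assume i: "i \<in> {1..n}"
  have zero: "d = 0" if \<iota>: "\<iota> \<in> indices n D W"
    and d: "((\<lambda>x. component \<iota> (c(i := c i + x))) has_field_derivative d) (at 0)" for \<iota> d
  proof (rule derivative_zero_if_quadratic[OF d])
    \<comment> \<open>the summand \<open>1 / R\<close> in the constant confines the perturbed point to the ball\<close>
    define R where "R = 1 - cn_norm n c"
    have R: "R > 0" using cn_ball_norm[OF c] by (simp add: R_def)
    show "K + 1 / R \<ge> 0" using K R by simp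
    fix x :: complex assume x: "(K + 1 / R) * cmod x < 1"
    define w where "w = c(i := c i + x)"
    have diff: "cn_norm n (\<lambda>l. w l - c l) = cmod x"
    proof -
      have "(cn_norm n (\<lambda>l. w l - c l))\<^sup>2 = (\<Sum>l=1..n. if l = i then (cmod x)\<^sup>2 else 0)"
        unfolding cn_norm_power2 by (rule sum.cong) (auto simp: w_def)
      then show ?thesis using i by simp
    qed
    have Kx: "K * cmod x < 1" "cmod x < R"
    proof -
      have "K * cmod x + 1 / R * cmod x < 1" using x by (simp add: distrib_right)
      moreover have "K * cmod x \<ge> 0" "1 / R * cmod x \<ge> 0" using K R by auto
      ultimately have "K * cmod x < 1" "1 / R * cmod x < 1" by linarith+
      then show "K * cmod x < 1" "cmod x < R" using R by (auto simp: field_simps)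
    qed
    have "cn_norm n w \<le> L2_set (\<lambda>l. cmod (w l - c l) + cmod (c l)) {1..n}"
      unfolding cn_norm_def by (rule L2_set_mono) (use norm_triangle_sub in \<open>auto simp: add.commute\<close>)
    also have "\<dots> \<le> cn_norm n (\<lambda>l. w l - c l) + cn_norm n c"
      unfolding cn_norm_def by (rule L2_set_triangle_ineq)
    also have "\<dots> < 1" using Kx(2) by (simp add: diff R_def)
    finally have w: "w \<in> cn_ball n"
      using cn_ball_space[OF c] i by (auto simp: cn_ball_def cn_space_def w_def)
    have "\<iota> \<in> b ` {1..N}" using b \<iota> by (simp add: bij_betw_def)
    then obtain j where j: "j \<in> {1..N}" "b j = \<iota>" by blast
    have "cmod (component \<iota> w - component \<iota> c)
        \<le> cn_norm N (\<lambda>j. component_map N b w j - component_map N b c j)"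
      using cn_norm_component_le[OF j(1), of "\<lambda>j. component_map N b w j - component_map N b c j"] j
      by (simp add: component_map_def)
    also have "\<dots> \<le> K * (cmod x)\<^sup>2" using crit[OF w] Kx(1) by (simp add: diff)
    also have "\<dots> \<le> (K + 1 / R) * (cmod x)\<^sup>2" by (rule mult_right_mono) (use R in auto)
    finally show "cmod (component \<iota> (c(i := c i + x)) - component \<iota> (c(i := c i + 0)))
        \<le> (K + 1 / R) * (cmod x)\<^sup>2" by (simp add: w_def)
  qed
  have "(2 * c i - 3 * c i ^ 2) / of_real (sqrt 6) = 0"
    by (rule zero[of "Minus i"])
      (use i in \<open>auto simp: indices_def power2_eq_square intro!: derivative_eq_intros\<close>)
  moreover have "((\<lambda>x. component (Plus i i) (c(i := c i + x)))
      has_field_derivative (3 * c i ^ 2 + 4 * c i ^ 3) / of_real (sqrt 6)) (at 0)"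
    unfolding component.simps fun_upd_same
    by (rule DERIV_cdivide)
      (auto intro!: derivative_eq_intros simp: power2_eq_square power3_eq_cube algebra_simps)
  then have "(3 * c i ^ 2 + 4 * c i ^ 3) / of_real (sqrt 6) = 0"
    by (rule zero[rotated]) (use i in \<open>auto simp: indices_def\<close>)
  ultimately have "c i * (2 - 3 * c i) = 0" "c i ^ 2 * (3 + 4 * c i) = 0"
    by (simp_all add: algebra_simps power2_eq_square power3_eq_cube)
  then have factors: "c i = 0 \<or> 2 - 3 * c i = 0" "c i = 0 \<or> 3 + 4 * c i = 0" by simp_all
  show "c i = 0"
  proof (rule ccontr)
    assume "c i \<noteq> 0"
    then have zeros: "2 - 3 * c i = 0" "3 + 4 * c i = 0" using factors by blast+
    have "17 = 4 * (2 - 3 * c i) + 3 * (3 + 4 * c i)" by (simp add: algebra_simps)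
    then show False unfolding zeros by simp
  qed
qed

text \<open>Since both \<open>\<gamma>\<close> and \<open>\<psi>\<close> preserve the norm, \<open>\<parallel>f (\<gamma> z)\<parallel> = \<parallel>f z\<parallel>\<close>; the terms depending on
  \<open>\<parallel>z\<parallel>\<close> alone cancel and leave the invariance of the defect.\<close>

lemma hermitian_invariant_group_component_map:
  "hermitian_invariant_group n N (component_map N b) = perm_unitary n ` G"
proof (intro equalityI subsetI)
  fix \<gamma> assume "\<gamma> \<in> perm_unitary n ` G"
  then show "\<gamma> \<in> hermitian_invariant_group n N (component_map N b)"
    using perm_unitary_in_hermitian_invariant_group by blast
next
  let ?f = "component_map N b"
  fix \<gamma> assume "\<gamma> \<in> hermitian_invariant_group n N ?f"
  then obtain \<psi> where \<gamma>: "\<gamma> \<in> Aut_ball n" and \<psi>: "\<psi> \<in> Aut_ball N"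
    and comm: "\<And>z. z \<in> cn_ball n \<Longrightarrow> ?f (\<gamma> z) = \<psi> (?f z)"
    unfolding hermitian_invariant_group_def by blast
  have \<gamma>B: "\<gamma> z \<in> cn_ball n" if "z \<in> cn_ball n" for z using Aut_ballD(2)[OF \<gamma>] that by auto
  have fB: "?f z \<in> cn_ball N" if "z \<in> cn_ball n" for z using component_map_ball that by auto
  have \<gamma>0: "\<gamma> (\<lambda>i. 0) = (\<lambda>i. 0)"
  proof (rule intertwined_critical_point[OF \<gamma> \<psi> comm component_map_ball component_map_le])
    fix K assume "K \<ge> 0" "\<And>w. w \<in> cn_ball n \<Longrightarrow> K * cn_norm n (\<lambda>i. w i - \<gamma> (\<lambda>i. 0) i) < 1 \<Longrightarrow>
      cn_norm N (\<lambda>j. ?f w j - ?f (\<gamma> (\<lambda>i. 0)) j) \<le> K * (cn_norm n (\<lambda>i. w i - \<gamma> (\<lambda>i. 0) i))\<^sup>2"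
    then show ?thesis by (rule critical_point_is_origin[OF \<gamma>B[OF zero_in_cn_ball]])
  qed
  have f0: "?f (\<lambda>i. 0) = (\<lambda>i. 0)"
  proof -
    have "cn_norm N (?f (\<lambda>i. 0)) = 0"
      using component_map_le[OF zero_in_cn_ball] by (intro antisym) simp_all
    then show ?thesis by (simp only: cn_norm_eq_0_iff[OF component_map_space])
  qed
  have \<psi>0: "\<psi> (\<lambda>j. 0) = (\<lambda>j. 0)" using comm[OF zero_in_cn_ball] by (simp add: \<gamma>0 f0)
  have defect: "defect n W (\<gamma> z) = defect n W z" if z: "z \<in> cn_ball n" for z
  proof -
    have "cn_norm N (?f (\<gamma> z)) = cn_norm N (?f z)"
      by (simp only: comm[OF z] Aut_ball_norm[OF \<psi> \<psi>0 fB[OF z]])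
    then have "(cn_norm N (?f (\<gamma> z)))\<^sup>2 = (cn_norm N (?f z))\<^sup>2" by simp
    then have "(1 - (cn_norm n z)\<^sup>2) * defect n W (\<gamma> z) = (1 - (cn_norm n z)\<^sup>2) * defect n W z"
      by (simp only: component_map_norm Aut_ball_norm[OF \<gamma> \<gamma>0 z])
    moreover have "1 - (cn_norm n z)\<^sup>2 \<noteq> 0"
      using cn_ball_norm[OF z] by (simp add: cn_norm_less_1_iff)
    ultimately show ?thesis by simp
  qed
  obtain \<sigma> where \<sigma>: "\<sigma> permutes {1..n}" and \<gamma>\<sigma>: "\<gamma> = perm_unitary n \<sigma>"
    by (rule defect_preserving_Aut_is_permutation[OF \<gamma> \<gamma>0 defect]) (assumption | rule that)+
  have "\<sigma> \<in> G"
  proof (rule W_sep[OF \<sigma>])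
    fix z assume z: "z \<in> cn_ball n"
    have "(\<Sum>i=1..n. (cmod (z (inv' \<sigma> i) ^ 2 + z (inv' \<sigma> i) ^ 3))\<^sup>2) = (\<Sum>i=1..n. (cmod (z i ^ 2 + z i ^ 3))\<^sup>2)"
      by (rule sum_permute_inv[OF \<sigma>])
    then show "(\<Sum>w\<in>W. (cmod (wmon z (map (inv' \<sigma>) w)))\<^sup>2) = (\<Sum>w\<in>W. (cmod (wmon z w))\<^sup>2)"
      using defect[OF z] z by (simp add: \<gamma>\<sigma> perm_unitary_def defect_def wmon_map)
  qed
  then show "\<gamma> \<in> perm_unitary n ` G" using \<gamma>\<sigma> by blast
qed

end

end

theorem theorem6p3:
  fixes n :: nat and G :: "(nat \<Rightarrow> nat) set"
  assumes "subgroup G (sym_group n)"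
  shows "\<exists>(N :: nat) (f :: (nat \<Rightarrow> complex) \<Rightarrow> nat \<Rightarrow> complex).
           polynomial_ball_map n N f \<and> proper_holomorphic_ball_map n N f \<and>
           hermitian_invariant_group n N f = perm_unitary n ` G"
proof -
  obtain D W where "separating_words n G D W" using separating_words_exist[OF assms] by blast
  then interpret separating_words n G D W .
  obtain b where "bij_betw b {1..card (indices n D W)} (indices n D W)"
    using ex_bij_betw_nat_finite_1[OF finite_indices[OF W]] by blast
  then show ?thesis
    using component_map_polynomial component_map_proper hermitian_invariant_group_component_map by blast
qed

end
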